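(* Let $(E,\|\cdot\|)$ be an $L^0$-normed module whose sum preserves the relative countable concatenation property. Let $\{X_\gamma\}_{\gamma\in\Gamma}$ be a net in $E$ which converges weakly (i.e. in the topology $\sigma(E,E^* )$) to $X\in E$. Then for any $\varepsilon\in L^0_{++}$ there exists $$Z_\varepsilon\in\overline{\mathrm{co}}^{cc}_{L^0}\{X_\gamma:\gamma\in\Gamma\}\quad\text{such that}\quad \|X-Z_\varepsilon\|\le\varepsilon .$$
   Context: Fix a probability space $(\Omega,\mathcal F,\mathbb P)$. $L^0$ is the ring of equivalence classes (modulo almost sure equality) of real-valued $\mathcal F$-measurable random variables, ordered by almost sure dominance: $X\ge Y$ means $\mathbb P(X\ge Y)=1$, and $X>Y$ means $\mathbb P(X>Y)=1$. $L^0_+=\{Y\in L^0: Y\ge 0\}$ and $L^0_{++}=\{Y\in L^0: Y>0\}$. $L^0$ carries the topology $|\cdot|$ in which a neighborhood base of $Y$ is $\{Y+B_\varepsilon:\varepsilon\in L^0_{++}\}$, with $B_\varepsilon=\{Z\in L^0:|Z|\le\varepsilon\}$. $L^0$-normed module: an $L^0$-seminorm on an $L^0$-module $E$ is a map $\|\cdot\|:E\to L^0_+$ with $\|YX\|=|Y|\,\|X\|$ for $Y\in L^0$, $X\in E$, and $\|X_1+X_2\|\le\|X_1\|+\|X_2\|$. It is an $L^0$-norm if moreover $\|X\|=0$ implies $X=0$. An $L^0$-normed module is an $L^0$-module $E$ with an $L^0$-norm. A family $\mathcal P$ of $L^0$-seminorms induces the topology on $E$ in which a neighborhood base of $X$ is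 given by the sets $X+U_{Q,\varepsilon}$, where $U_{Q,\varepsilon}=\{Z\in E:\sup_{q\in Q}q(Z)\le\varepsilon\}$, $Q\subset\mathcal P$ is finite and $\varepsilon\in L^0_{++}$. The norm topology is the one induced by $\{\|\cdot\|\}$. Weak topology: $E^*$ is the $L^0$-module of $L^0$-linear maps $E\to L^0$ that are continuous from the norm topology to the topology $|\cdot|$ of $L^0$. The weak topology $\sigma(E,E^* )$ is the topology induced by the family of $L^0$-seminorms $q_{X^*}(X)=|X^*(X)|$, $X^*\in E^*$. Countable concatenations: $\Pi(\Omega,\mathcal F)$ is the set of countable partitions $\{A_n\}_{n\in\mathbb N}$ of $\Omega$ into elements of $\mathcal F$, and $1_A\in L^0$ is the class of the indicator function of $A$. For a sequence $\{X_n\}$ in $E$ and $\{A_n\}\in\Pi(\Omega,\mathcal F)$, let $cc(\{A_n\},\{X_n\})=\{X\in E: 1_{A_n}X_n=1_{A_n}X\text{ for each }n\in\mathbb N\}$ (this set may be empty or have more than one element). A subset $K\subset E$ has the relative countable concatenation property if $cc(\{A_n\},\{X_n\})\subset K$ for every sequence $\{X_n\}$ in $K$ and every $\{A_n\}\in\Pi(\Omega,\mathcal F)$. The countable concatenation closure of $K$ is $\overline K^{cc}=\bigcup cc(\{A_n\},\{X_n\})$, the union being over all $\{A_n\}\in\Pi(\Omega,\mathcal F)$ and all sequences $\{X_n\}$ in $K$. The sum of $E$ preserves the relative countable concatenation property if, for all subsets $L,M\subset E$ with the relative countable concatenation property, $L+M$ has the relative countable concatenation property. For $S\subset E$, $\mathrm{co}_{L^0}S$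 is the $L^0$-convex hull of $S$, i.e. the set of finite sums $\sum_{i=1}^N Y_iX_i$ with $N\ge1$, $X_i\in S$, $Y_i\in L^0_+$, $\sum_{i=1}^N Y_i=1$; and $\overline{\mathrm{co}}^{cc}_{L^0}S$ denotes the countable concatenation closure of $\mathrm{co}_{L^0}S$. *)

theory Defs
  imports "HOL-Probability.Probability" "HOL-Algebra.QuotRing" "HOL-Algebra.Module"
begin

section \<open>The ordered ring of random variables modulo almost sure equality\<close>

definition L0_fun :: "'w measure \<Rightarrow> ('w \<Rightarrow> real) ring" where
  "L0_fun M = \<lparr>carrier = borel_measurable M,
     mult = (\<lambda>f g w. f w * g w), one = (\<lambda>_. 1),
     zero = (\<lambda>_. 0), add = (\<lambda>f g w. f w + g w)\<rparr>"

definition L0_null :: "'w measure \<Rightarrow> ('w \<Rightarrow> real) set" where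
  "L0_null M = {f \<in> borel_measurable M. AE w in M. f w = 0}"

definition L0 :: "'w measure \<Rightarrow> ('w \<Rightarrow> real) set ring" where
  "L0 M = L0_fun M Quot L0_null M"

definition L0_class :: "'w measure \<Rightarrow> ('w \<Rightarrow> real) \<Rightarrow> ('w \<Rightarrow> real) set" where
  "L0_class M f = L0_null M +>\<^bsub>L0_fun M\<^esub> f"

text \<open>The order relations and the absolute value are given through representatives; the lemmas
  \<open>L0_le_class\<close>, \<open>L0_less_class\<close> and \<open>L0_abs_class\<close> below show that the choice is immaterial.\<close>

definition L0_le :: "'w measure \<Rightarrow> ('w \<Rightarrow> real) set \<Rightarrow> ('w \<Rightarrow> real) set \<Rightarrow> bool" where
  "L0_le M X Y \<longleftrightarrow> (\<exists>f\<in>X. \<exists>g\<in>Y. AE w in M. f w \<le> g w)"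

definition L0_less :: "'w measure \<Rightarrow> ('w \<Rightarrow> real) set \<Rightarrow> ('w \<Rightarrow> real) set \<Rightarrow> bool" where
  "L0_less M X Y \<longleftrightarrow> (\<exists>f\<in>X. \<exists>g\<in>Y. AE w in M. f w < g w)"

definition L0_abs :: "'w measure \<Rightarrow> ('w \<Rightarrow> real) set \<Rightarrow> ('w \<Rightarrow> real) set" where
  "L0_abs M X = (\<Union>f\<in>X. L0_class M (\<lambda>w. \<bar>f w\<bar>))"

definition L0_plus :: "'w measure \<Rightarrow> ('w \<Rightarrow> real) set set" where
  "L0_plus M = {Y \<in> carrier (L0 M). L0_le M \<zero>\<^bsub>L0 M\<^esub> Y}"

definition L0_pp :: "'w measure \<Rightarrow> ('w \<Rightarrow> real) set set" where
  "L0_pp M = {Y \<in> carrier (L0 M). L0_less M \<zero>\<^bsub>L0 M\<^esub> Y}"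

definition L0_ind :: "'w measure \<Rightarrow> 'w set \<Rightarrow> ('w \<Rightarrow> real) set" where
  "L0_ind M A = L0_class M (indicator A)"

lemma cring_L0_fun: "cring (L0_fun M)"
proof (rule cringI)
  show "abelian_group (L0_fun M)"
  proof (rule abelian_groupI)
    fix f assume "f \<in> carrier (L0_fun M)"
    then have "(\<lambda>w. - f w) \<in> carrier (L0_fun M)"
      and "(\<lambda>w. - f w) \<oplus>\<^bsub>L0_fun M\<^esub> f = \<zero>\<^bsub>L0_fun M\<^esub>"
      by (auto simp: L0_fun_def)
    then show "\<exists>g\<in>carrier (L0_fun M). g \<oplus>\<^bsub>L0_fun M\<^esub> f = \<zero>\<^bsub>L0_fun M\<^esub>"
      by blast
  qed (auto simp: L0_fun_def algebra_simps)
  show "comm_monoid (L0_fun M)"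
    by (rule comm_monoidI) (auto simp: L0_fun_def algebra_simps)
qed (auto simp: L0_fun_def algebra_simps)

lemma L0_fun_a_inv:
  assumes "f \<in> borel_measurable M"
  shows "\<ominus>\<^bsub>L0_fun M\<^esub> f = (\<lambda>w. - f w)"
proof -
  interpret R: cring "L0_fun M" by (rule cring_L0_fun)
  show ?thesis
    by (rule R.minus_equality) (use assms in \<open>auto simp: L0_fun_def\<close>)
qed

lemma ideal_L0_null: "ideal (L0_null M) (L0_fun M)"
proof -
  interpret R: cring "L0_fun M" by (rule cring_L0_fun)
  show ?thesis
  proof (rule idealI)
    show "subgroup (L0_null M) (add_monoid (L0_fun M))"
    proof (rule R.add.subgroupI)
      show "L0_null M \<noteq> {}"
        by (auto simp: L0_null_def intro!: exI[of _ "\<lambda>_. 0"])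
      show "\<ominus>\<^bsub>L0_fun M\<^esub> f \<in> L0_null M" if "f \<in> L0_null M" for f
        using that L0_fun_a_inv[of f M] by (auto simp: L0_null_def)
    qed (auto simp: L0_fun_def L0_null_def)
  qed (rule R.ring_axioms, auto simp: L0_fun_def L0_null_def)
qed

lemma cring_L0: "cring (L0 M)"
  unfolding L0_def by (rule ideal.quotient_is_cring[OF ideal_L0_null cring_L0_fun])

lemma L0_class_eq:
  assumes f: "f \<in> borel_measurable M"
  shows "L0_class M f = {g \<in> borel_measurable M. AE w in M. g w = f w}"
proof (intro equalityI subsetI)
  fix g assume "g \<in> L0_class M f"
  then show "g \<in> {g \<in> borel_measurable M. AE w in M. g w = f w}"
    using f by (auto simp: L0_class_def a_r_coset_def' L0_fun_def L0_null_def)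
next
  fix g assume g: "g \<in> {g \<in> borel_measurable M. AE w in M. g w = f w}"
  then have "(\<lambda>w. g w - f w) \<in> L0_null M" using f by (auto simp: L0_null_def)
  then show "g \<in> L0_class M f"
    unfolding L0_class_def a_r_coset_def' L0_fun_def
    by (auto intro!: bexI[of _ "\<lambda>w. g w - f w"])
qed

lemma carrier_L0: "carrier (L0 M) = L0_class M ` borel_measurable M"
  by (auto simp: L0_def FactRing_def A_RCOSETS_def' L0_class_def L0_fun_def)

lemma zero_L0: "\<zero>\<^bsub>L0 M\<^esub> = L0_class M (\<lambda>_. 0)"
  by (subst L0_class_eq) (auto simp: L0_def FactRing_def L0_null_def)

lemma one_L0: "\<one>\<^bsub>L0 M\<^esub> = L0_class M (\<lambda>_. 1)"
  by (simp add: L0_def FactRing_def L0_class_def L0_fun_def)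

lemma add_L0:
  assumes "f \<in> borel_measurable M" "g \<in> borel_measurable M"
  shows "L0_class M f \<oplus>\<^bsub>L0 M\<^esub> L0_class M g = L0_class M (\<lambda>w. f w + g w)"
  using ring_hom_add[OF ideal.rcos_ring_hom[OF ideal_L0_null[of M]], of f g] assms
  by (simp add: L0_def L0_class_def L0_fun_def)

lemma mult_L0:
  assumes "f \<in> borel_measurable M" "g \<in> borel_measurable M"
  shows "L0_class M f \<otimes>\<^bsub>L0 M\<^esub> L0_class M g = L0_class M (\<lambda>w. f w * g w)"
  using ideal.rcoset_mult_add[OF ideal_L0_null[of M], of f g] assms
  by (simp add: L0_def FactRing_def L0_class_def L0_fun_def)

lemma L0_le_class:
  assumes "f \<in> borel_measurable M" "g \<in> borel_measurable M"
  shows "L0_le M (L0_class M f) (L0_class M g) \<longleftrightarrow> (AE w in M. f w \<le> g w)"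
proof
  assume "L0_le M (L0_class M f) (L0_class M g)"
  then obtain f' g' where "AE w in M. f' w = f w" "AE w in M. g' w = g w"
    "AE w in M. f' w \<le> g' w"
    using assms by (auto simp: L0_le_def L0_class_eq)
  then show "AE w in M. f w \<le> g w" by eventually_elim simp
qed (use assms in \<open>auto simp: L0_le_def L0_class_eq\<close>)

lemma L0_less_class:
  assumes "f \<in> borel_measurable M" "g \<in> borel_measurable M"
  shows "L0_less M (L0_class M f) (L0_class M g) \<longleftrightarrow> (AE w in M. f w < g w)"
proof
  assume "L0_less M (L0_class M f) (L0_class M g)"
  then obtain f' g' where "AE w in M. f' w = f w" "AE w in M. g' w = g w"
    "AE w in M. f' w < g' w"
    using assms by (auto simp: L0_less_def L0_class_eq)
  then show "AE w in M. f w < g w" by eventually_elim simp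
qed (use assms in \<open>auto simp: L0_less_def L0_class_eq\<close>)

lemma L0_abs_class:
  assumes f: "f \<in> borel_measurable M"
  shows "L0_abs M (L0_class M f) = L0_class M (\<lambda>w. \<bar>f w\<bar>)"
proof -
  have "L0_class M (\<lambda>w. \<bar>g w\<bar>) = L0_class M (\<lambda>w. \<bar>f w\<bar>)" if "g \<in> L0_class M f" for g
  proof -
    have g: "g \<in> borel_measurable M" and gf: "AE w in M. g w = f w"
      using that f by (auto simp: L0_class_eq)
    from gf have "(AE w in M. h w = \<bar>g w\<bar>) \<longleftrightarrow> (AE w in M. h w = \<bar>f w\<bar>)" for h :: "'a \<Rightarrow> real"
      by (intro eventually_cong) auto
    then show ?thesis using f g by (simp add: L0_class_eq)
  qed
  moreover have "f \<in> L0_class M f" using f by (simp add: L0_class_eq)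
  ultimately show ?thesis unfolding L0_abs_def by blast
qed

lemma L0_pp_iff:
  "Y \<in> L0_pp M \<longleftrightarrow> (\<exists>f\<in>borel_measurable M. Y = L0_class M f \<and> (AE w in M. 0 < f w))"
  by (auto simp: L0_pp_def carrier_L0 zero_L0 L0_less_class)

lemma L0_le_trans:
  assumes "L0_le M X Y" "L0_le M Y Z" "Y \<in> carrier (L0 M)"
  shows "L0_le M X Z"
proof -
  from assms obtain f g g' h k where *: "f \<in> X" "h \<in> Z" "AE w in M. f w \<le> g w"
    "AE w in M. g' w \<le> h w" "AE w in M. g w = k w" "AE w in M. g' w = k w"
    by (auto simp: L0_le_def carrier_L0 L0_class_eq)
  from *(3-) have "AE w in M. f w \<le> h w" by eventually_elim simp
  with * show ?thesis by (auto simp: L0_le_def)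
qed

lemma L0_pp_lower:
  assumes "d \<in> L0_pp M" "e \<in> L0_pp M"
  obtains c where "c \<in> L0_pp M" "L0_le M c d" "L0_le M c e"
proof -
  from assms obtain f g where fg: "f \<in> borel_measurable M" "d = L0_class M f" "AE w in M. 0 < f w"
    "g \<in> borel_measurable M" "e = L0_class M g" "AE w in M. 0 < g w"
    by (auto simp: L0_pp_iff)
  let ?h = "\<lambda>w. min (f w) (g w)"
  from fg(3,6) have "AE w in M. 0 < ?h w" by eventually_elim simp
  with fg have "L0_class M ?h \<in> L0_pp M" "L0_le M (L0_class M ?h) d" "L0_le M (L0_class M ?h) e"
    by (auto simp: L0_pp_iff L0_le_class intro!: bexI[of _ ?h])
  then show ?thesis by (rule that)
qed

section \<open>Normed modules and their topologies\<close>

definition L0_seminorm ::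
  "'w measure \<Rightarrow> (('w \<Rightarrow> real) set, 'e) module \<Rightarrow> ('e \<Rightarrow> ('w \<Rightarrow> real) set) \<Rightarrow> bool" where
  "L0_seminorm M E p \<longleftrightarrow>
     p \<in> carrier E \<rightarrow> L0_plus M \<and>
     (\<forall>Y\<in>carrier (L0 M). \<forall>x\<in>carrier E. p (Y \<odot>\<^bsub>E\<^esub> x) = L0_abs M Y \<otimes>\<^bsub>L0 M\<^esub> p x) \<and>
     (\<forall>x\<in>carrier E. \<forall>y\<in>carrier E. L0_le M (p (x \<oplus>\<^bsub>E\<^esub> y)) (p x \<oplus>\<^bsub>L0 M\<^esub> p y))"

definition L0_norm ::
  "'w measure \<Rightarrow> (('w \<Rightarrow> real) set, 'e) module \<Rightarrow> ('e \<Rightarrow> ('w \<Rightarrow> real) set) \<Rightarrow> bool" where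
  "L0_norm M E p \<longleftrightarrow> L0_seminorm M E p \<and>
     (\<forall>x\<in>carrier E. p x = \<zero>\<^bsub>L0 M\<^esub> \<longrightarrow> x = \<zero>\<^bsub>E\<^esub>)"

definition L0_normed_module ::
  "'w measure \<Rightarrow> (('w \<Rightarrow> real) set, 'e) module \<Rightarrow> ('e \<Rightarrow> ('w \<Rightarrow> real) set) \<Rightarrow> bool" where
  "L0_normed_module M E p \<longleftrightarrow> Module.module (L0 M) E \<and> L0_norm M E p"

text \<open>The condition \<open>sup {q z | q \<in> Q} \<le> \<epsilon>\<close> is spelled out as \<open>q z \<le> \<epsilon>\<close> for each \<open>q \<in> Q\<close>; for
  empty \<open>Q\<close> the supremum in the nonnegative cone is zero and the ball is the whole module.
  The group is an arbitrary ring scheme, so that \<open>L0 M\<close> itself is also an instance.\<close>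

definition L0_ball ::
  "'w measure \<Rightarrow> ('e, 'b) ring_scheme \<Rightarrow> ('e \<Rightarrow> ('w \<Rightarrow> real) set) set \<Rightarrow> ('w \<Rightarrow> real) set \<Rightarrow> 'e set"
  where "L0_ball M E Q \<epsilon> = {z \<in> carrier E. \<forall>q\<in>Q. L0_le M (q z) \<epsilon>}"

definition seminorm_open ::
  "'w measure \<Rightarrow> ('e, 'b) ring_scheme \<Rightarrow> ('e \<Rightarrow> ('w \<Rightarrow> real) set) set \<Rightarrow> 'e set \<Rightarrow> bool" where
  "seminorm_open M E P U \<longleftrightarrow> U \<subseteq> carrier E \<and>
     (\<forall>x\<in>U. \<exists>Q \<epsilon>. finite Q \<and> Q \<subseteq> P \<and> \<epsilon> \<in> L0_pp M \<and>
        (\<forall>z\<in>L0_ball M E Q \<epsilon>. x \<oplus>\<^bsub>E\<^esub> z \<in> U))"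

definition seminorm_topology ::
  "'w measure \<Rightarrow> ('e, 'b) ring_scheme \<Rightarrow> ('e \<Rightarrow> ('w \<Rightarrow> real) set) set \<Rightarrow> 'e topology" where
  "seminorm_topology M E P = topology (seminorm_open M E P)"

lemma istopology_seminorm_open: "istopology (seminorm_open M E P)"
  unfolding istopology_def
proof (intro conjI allI impI)
  fix S T assume S: "seminorm_open M E P S" and T: "seminorm_open M E P T"
  show "seminorm_open M E P (S \<inter> T)"
    unfolding seminorm_open_def
  proof (intro conjI ballI)
    show "S \<inter> T \<subseteq> carrier E" using S by (auto simp: seminorm_open_def)
    fix x assume x: "x \<in> S \<inter> T"
    from S x obtain Q d where Q: "finite Q" "Q \<subseteq> P" "d \<in> L0_pp M"
      "\<forall>z\<in>L0_ball M E Q d. x \<oplus>\<^bsub>E\<^esub> z \<in> S"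
      unfolding seminorm_open_def by (metis IntD1)
    from T x obtain R e where R: "finite R" "R \<subseteq> P" "e \<in> L0_pp M"
      "\<forall>z\<in>L0_ball M E R e. x \<oplus>\<^bsub>E\<^esub> z \<in> T"
      unfolding seminorm_open_def by (metis IntD2)
    obtain c where c: "c \<in> L0_pp M" "L0_le M c d" "L0_le M c e"
      using L0_pp_lower[OF Q(3) R(3)] .
    then have "L0_ball M E (Q \<union> R) c \<subseteq> L0_ball M E Q d \<inter> L0_ball M E R e"
      by (auto simp: L0_ball_def L0_pp_def intro: L0_le_trans)
    with Q R c show "\<exists>Q \<epsilon>. finite Q \<and> Q \<subseteq> P \<and> \<epsilon> \<in> L0_pp M \<and>
        (\<forall>z\<in>L0_ball M E Q \<epsilon>. x \<oplus>\<^bsub>E\<^esub> z \<in> S \<inter> T)"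
      by (intro exI[of _ "Q \<union> R"] exI[of _ c]) blast
  qed
next
  fix K assume K: "\<forall>S\<in>K. seminorm_open M E P S"
  show "seminorm_open M E P (\<Union>K)"
    unfolding seminorm_open_def
  proof (intro conjI ballI)
    show "\<Union>K \<subseteq> carrier E" using K by (auto simp: seminorm_open_def)
    fix x assume "x \<in> \<Union>K"
    then obtain S where S: "S \<in> K" "x \<in> S" by blast
    with K obtain Q d where "finite Q" "Q \<subseteq> P" "d \<in> L0_pp M"
      "\<forall>z\<in>L0_ball M E Q d. x \<oplus>\<^bsub>E\<^esub> z \<in> S"
      unfolding seminorm_open_def by metis
    with S show "\<exists>Q \<epsilon>. finite Q \<and> Q \<subseteq> P \<and> \<epsilon> \<in> L0_pp M \<and>
        (\<forall>z\<in>L0_ball M E Q \<epsilon>. x \<oplus>\<^bsub>E\<^esub> z \<in> \<Union>K)"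
      by blast
  qed
qed

lemma openin_seminorm_topology: "openin (seminorm_topology M E P) = seminorm_open M E P"
  by (simp add: seminorm_topology_def topology_inverse'[OF istopology_seminorm_open])

lemma topspace_seminorm_topology:
  assumes "abelian_group E"
  shows "topspace (seminorm_topology M E P) = carrier E"
proof -
  interpret abelian_group E by fact
  have "L0_class M (\<lambda>_. 1) \<in> L0_pp M"
    by (auto simp: L0_pp_iff intro!: bexI[of _ "\<lambda>_. 1"])
  then have "seminorm_open M E P (carrier E)"
    unfolding seminorm_open_def
    by (auto simp: L0_ball_def intro!: exI[of _ "{}"] exI[of _ "L0_class M (\<lambda>_. 1)"])
  then show ?thesis
    by (auto simp: topspace_def openin_seminorm_topology seminorm_open_def)
qed

definition L0_topology :: "'w measure \<Rightarrow> ('w \<Rightarrow> real) set topology" where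
  "L0_topology M = seminorm_topology M (L0 M) {L0_abs M}"

definition L0_dual ::
  "'w measure \<Rightarrow> (('w \<Rightarrow> real) set, 'e) module \<Rightarrow> ('e \<Rightarrow> ('w \<Rightarrow> real) set)
     \<Rightarrow> ('e \<Rightarrow> ('w \<Rightarrow> real) set) set" where
  "L0_dual M E p = {f \<in> carrier E \<rightarrow> carrier (L0 M).
     (\<forall>x\<in>carrier E. \<forall>y\<in>carrier E. f (x \<oplus>\<^bsub>E\<^esub> y) = f x \<oplus>\<^bsub>L0 M\<^esub> f y) \<and>
     (\<forall>Y\<in>carrier (L0 M). \<forall>x\<in>carrier E. f (Y \<odot>\<^bsub>E\<^esub> x) = Y \<otimes>\<^bsub>L0 M\<^esub> f x) \<and>
     continuous_map (seminorm_topology M E {p}) (L0_topology M) f}"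

definition weak_topology ::
  "'w measure \<Rightarrow> (('w \<Rightarrow> real) set, 'e) module \<Rightarrow> ('e \<Rightarrow> ('w \<Rightarrow> real) set) \<Rightarrow> 'e topology" where
  "weak_topology M E p = seminorm_topology M E ((\<lambda>f x. L0_abs M (f x)) ` L0_dual M E p)"

section \<open>Countable concatenations and convex hulls\<close>

text \<open>The pieces of a countable partition may be empty, so finite partitions are included.\<close>

definition ctbl_partition :: "'w measure \<Rightarrow> (nat \<Rightarrow> 'w set) \<Rightarrow> bool" where
  "ctbl_partition M A \<longleftrightarrow> range A \<subseteq> sets M \<and> disjoint_family A \<and> (\<Union>n. A n) = space M"

definition cc ::
  "'w measure \<Rightarrow> (('w \<Rightarrow> real) set, 'e) module \<Rightarrow> (nat \<Rightarrow> 'w set) \<Rightarrow> (nat \<Rightarrow> 'e) \<Rightarrow> 'e set" where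
  "cc M E A X = {x \<in> carrier E. \<forall>n. L0_ind M (A n) \<odot>\<^bsub>E\<^esub> X n = L0_ind M (A n) \<odot>\<^bsub>E\<^esub> x}"

definition rel_cc_property ::
  "'w measure \<Rightarrow> (('w \<Rightarrow> real) set, 'e) module \<Rightarrow> 'e set \<Rightarrow> bool" where
  "rel_cc_property M E K \<longleftrightarrow>
     (\<forall>A X. ctbl_partition M A \<and> range X \<subseteq> K \<longrightarrow> cc M E A X \<subseteq> K)"

definition cc_closure ::
  "'w measure \<Rightarrow> (('w \<Rightarrow> real) set, 'e) module \<Rightarrow> 'e set \<Rightarrow> 'e set" where
  "cc_closure M E K = \<Union>{cc M E A X |A X. ctbl_partition M A \<and> range X \<subseteq> K}"

definition sum_preserves_rel_cc ::
  "'w measure \<Rightarrow> (('w \<Rightarrow> real) set, 'e) module \<Rightarrow> bool" where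
  "sum_preserves_rel_cc M E \<longleftrightarrow>
     (\<forall>K L. K \<subseteq> carrier E \<and> L \<subseteq> carrier E \<and> rel_cc_property M E K \<and> rel_cc_property M E L
        \<longrightarrow> rel_cc_property M E (K <+>\<^bsub>E\<^esub> L))"

definition L0_convex_hull ::
  "'w measure \<Rightarrow> (('w \<Rightarrow> real) set, 'e) module \<Rightarrow> 'e set \<Rightarrow> 'e set" where
  "L0_convex_hull M E S =
     {(\<Oplus>\<^bsub>E\<^esub>i\<in>{1..N}. Y i \<odot>\<^bsub>E\<^esub> X i) |(N::nat) Y X.
        1 \<le> N \<and> (\<forall>i\<in>{1..N}. X i \<in> S \<and> Y i \<in> L0_plus M) \<and>
        (\<Oplus>\<^bsub>L0 M\<^esub>i\<in>{1..N}. Y i) = \<one>\<^bsub>L0 M\<^esub>}"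

section \<open>Nets\<close>

definition directed_on :: "'i set \<Rightarrow> 'i rel \<Rightarrow> bool" where
  "directed_on \<Gamma> r \<longleftrightarrow> \<Gamma> \<noteq> {} \<and> preorder_on \<Gamma> r \<and>
     (\<forall>a\<in>\<Gamma>. \<forall>b\<in>\<Gamma>. \<exists>c\<in>\<Gamma>. (a, c) \<in> r \<and> (b, c) \<in> r)"

definition tail_filter :: "'i set \<Rightarrow> 'i rel \<Rightarrow> 'i filter" where
  "tail_filter \<Gamma> r = (\<Sqinter>a\<in>\<Gamma>. principal {b \<in> \<Gamma>. (a, b) \<in> r})"

lemma eventually_tail_filter:
  assumes "directed_on \<Gamma> r"
  shows "eventually P (tail_filter \<Gamma> r) \<longleftrightarrow> (\<exists>a\<in>\<Gamma>. \<forall>b\<in>\<Gamma>. (a, b) \<in> r \<longrightarrow> P b)"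
proof -
  have tr: "trans r" and ne: "\<Gamma> \<noteq> {}"
    using assms by (auto simp: directed_on_def preorder_on_def)
  have "\<exists>c\<in>\<Gamma>. principal {x \<in> \<Gamma>. (c, x) \<in> r}
      \<le> inf (principal {x \<in> \<Gamma>. (a, x) \<in> r}) (principal {x \<in> \<Gamma>. (b, x) \<in> r})"
    if ab: "a \<in> \<Gamma>" "b \<in> \<Gamma>" for a b
  proof -
    obtain c where "c \<in> \<Gamma>" "(a, c) \<in> r" "(b, c) \<in> r"
      using assms ab by (auto simp: directed_on_def)
    then show ?thesis using transD[OF tr] by (intro bexI[of _ c]) auto
  qed
  then show ?thesis
    unfolding tail_filter_def
    by (subst eventually_INF_base) (auto simp: ne eventually_principal)
qed

end

theory Submission
  imports Defs
begin

text \<open>Let \<open>d\<close> be the essential infimum of the distances \<open>\<parallel>x - z\<parallel>\<close> over the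
\<open>L\<^sup>0\<close>-convex hull of the net. The claim is that \<open>d\<close> vanishes and that the approximating points can be glued together.

For the first part, a Hahn-Banach argument yields a continuous \<open>L\<^sup>0\<close>-linear functional \<open>f\<close> with
\<open>f (x - X\<^sub>\<gamma>) \<ge> d\<close> for the whole net (\<open>separating_functional\<close>). Weak convergence makes
\<open>f (x - X\<^sub>\<gamma>)\<close> smaller than any given positive constant for suitable \<open>\<gamma>\<close>, so \<open>d \<le> 0\<close>. The functional comes from
\<open>dominating_additive_map\<close>, which treats an arbitrary abelian group with a random seminorm. One considers
additively closed sets of pairs \<open>(u, c)\<close> with \<open>c \<le> \<parallel>u\<parallel>\<close>, each pair being
the demand \<open>c \<le> f u\<close>. A maximal such set determines \<open>f\<close>, since the Dedekind completeness of the random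
variables (\<open>essential_infimum\<close>) provides at each point a value that meets all demands. Linearity over
\<open>L\<^sup>0\<close>, where zero divisors would be an obstacle in an extension from submodule to submodule,
follows afterwards: a bounded additive map is automatically \<open>L\<^sup>0\<close>-linear (\<open>additive_smult\<close>).

For the second part, the essential infimum is already the infimum of a sequence of distances \<open>\<parallel>x - z\<^sub>n\<parallel>\<close>
with \<open>z\<^sub>n\<close> in the convex hull. Hence the probability space splits into countably many
pieces such that \<open>\<parallel>x - z\<^sub>n\<parallel> \<le> \<epsilon>\<close> on the \<open>n\<close>-th piece. The assumption on sums shows that \<open>x\<close> lies in the sum of the
countable concatenation closure of the hull and the ball of radius \<open>\<epsilon>\<close>
(\<open>cc_closure_approximation\<close>), which is the assertion.\<close>

section \<open>Essential infima of families of random variables\<close>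

text \<open>Among all sequences in \<open>F\<close> one minimises the integral of the pointwise infimum, because countably many
nearly optimal sequences can be merged into a single one. Adding one more member of \<open>F\<close> to an optimal
sequence cannot lower the integral, so it cannot lower the infimum on a set of positive measure.
Uniform bounds keep the integrals finite.\<close>

lemma (in prob_space) countable_infimum_attains:
  fixes F :: "('a \<Rightarrow> real) set"
  assumes ne: "F \<noteq> {}" and meas: "F \<subseteq> borel_measurable M"
    and bounds: "\<forall>f\<in>F. \<forall>w. a \<le> f w \<and> f w \<le> b"
  obtains t :: "nat \<Rightarrow> 'a \<Rightarrow> real" where "range t \<subseteq> F"
    "\<And>g. g \<in> F \<Longrightarrow> AE w in M. (INF n. t n w) \<le> g w"
proof -
  define J where "J t w = (INF n. t n w)" for t :: "nat \<Rightarrow> 'a \<Rightarrow> real" and w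
  define T where "T = {t :: nat \<Rightarrow> 'a \<Rightarrow> real. range t \<subseteq> F}"
  have bdd: "bdd_below (range (\<lambda>n. t n w))" if "t \<in> T" for t w
    using that bounds by (intro bdd_belowI[of _ a]) (auto simp: T_def)
  have Jle: "J t w \<le> t n w" if "t \<in> T" for t n w
    unfolding J_def by (rule cINF_lower[OF bdd[OF that]]) simp
  have Jm: "J t \<in> borel_measurable M" if "t \<in> T" for t
    unfolding J_def using that meas
    by (intro borel_measurable_cINF_real) (auto simp: T_def)
  have Jlow: "a \<le> J t w" if "t \<in> T" for t w
    unfolding J_def using that bounds by (intro cINF_greatest) (auto simp: T_def)
  have Jup: "J t w \<le> b" if "t \<in> T" for t w
  proof -
    have "t 0 \<in> F" using that unfolding T_def by blast
    then have "t 0 w \<le> b" using bounds by blast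
    with Jle[OF that, of w 0] show ?thesis by linarith
  qed
  have Jint: "integrable M (J t)" if "t \<in> T" for t
    using Jm[OF that] Jlow[OF that] Jup[OF that]
    by (intro integrable_const_bound[of _ "max \<bar>a\<bar> \<bar>b\<bar>"]) (auto intro!: AE_I2, smt (verit))
  have Jmono: "J t w \<le> J s w" if "t \<in> T" "s \<in> T" "range s \<subseteq> range t" for t s w
    unfolding J_def[of s]
  proof (rule cINF_greatest)
    fix n show "J t w \<le> s n w" using that(3) Jle[OF that(1), of w] by (metis range_eqI subsetD imageE)
  qed simp
  define I where "I t = (\<integral>w. J t w \<partial>M)" for t
  have Ibdd: "bdd_below (I ` T)"
  proof (rule bdd_belowI2)
    fix t assume "t \<in> T"
    then have "(\<integral>w. a \<partial>M) \<le> I t"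
      unfolding I_def using Jint Jlow by (intro integral_mono) auto
    then show "a \<le> I t" by (simp add: prob_space)
  qed
  obtain f where f: "f \<in> F" using ne by auto
  then have Tne: "T \<noteq> {}" by (auto simp: T_def intro!: exI[of _ "\<lambda>_. f"])
  have "\<exists>t\<in>T. I t < (INF t\<in>T. I t) + 1 / real (Suc k)" for k
    using cINF_less_iff[OF Tne Ibdd, of "(INF t\<in>T. I t) + 1 / real (Suc k)"] by simp
  then obtain s where s: "\<And>k. s k \<in> T" "\<And>k. I (s k) < (INF t\<in>T. I t) + 1 / real (Suc k)"
    by metis
  define t where "t n = s (fst (prod_decode n)) (snd (prod_decode n))" for n
  have tT: "t \<in> T" using s(1) by (auto simp: T_def t_def)
  have range_s: "range (s k) \<subseteq> range t" for k
  proof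
    fix v assume "v \<in> range (s k)"
    then obtain n where "v = t (prod_encode (k, n))" by (auto simp: t_def)
    then show "v \<in> range t" by blast
  qed
  have "I t \<le> I (s k)" for k
    unfolding I_def by (rule integral_mono[OF Jint[OF tT] Jint[OF s(1)] Jmono[OF tT s(1) range_s]])
  then have le: "I t \<le> (INF t\<in>T. I t) + 1 / real (Suc k)" for k
    using s(2)[of k] by (meson le_less_trans less_imp_le)
  have It: "I t \<le> (INF t\<in>T. I t)"
  proof (rule field_le_epsilon)
    fix e :: real assume "0 < e"
    then obtain k where "1 / real (Suc k) < e" using nat_approx_posE by blast
    with le[of k] show "I t \<le> (INF t\<in>T. I t) + e" by linarith
  qed
  show ?thesis
  proof (rule that)
    show "range t \<subseteq> F" using tT by (simp add: T_def)
    fix g assume g: "g \<in> F"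
    define u where "u = case_nat g t"
    have uT: "u \<in> T" using g tT by (auto simp: T_def u_def image_subset_iff split: nat.splits)
    have "range t \<subseteq> range u" 
    proof
      fix v assume "v \<in> range t"
      then obtain n where "v = u (Suc n)" by (auto simp: u_def)
      then show "v \<in> range u" by blast
    qed
    then have le: "J u w \<le> J t w" for w by (rule Jmono[OF uT tT])
    have "I t \<le> I u" using It cINF_lower[OF Ibdd uT] by linarith
    then have "(\<integral>w. J t w - J u w \<partial>M) = 0"
      using integral_mono[OF Jint[OF uT] Jint[OF tT]] le
      by (simp add: Jint tT uT I_def)
    then have "AE w in M. J t w - J u w = 0"
      using integral_nonneg_eq_0_iff_AE[of M "\<lambda>w. J t w - J u w"] le Jint tT uT by simp
    then show "AE w in M. (INF n. t n w) \<le> g w"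
    proof eventually_elim
      case (elim w)
      then show ?case using Jle[OF uT, of w 0] by (simp add: u_def J_def[symmetric])
    qed
  qed
qed

text \<open>The Dedekind completeness of the random variables. The map \<open>arctan\<close> is strictly monotone and bounded,
so it reduces the claim to the uniformly bounded case. Besides being an almost sure lower bound,
\<open>h\<close> is approached pointwise along one fixed sequence \<open>t\<close>; this makes \<open>h\<close> the greatest lower
bound, and the sequence is what countable concatenations are formed from later on.\<close>

lemma (in prob_space) essential_infimum:
  fixes F :: "('a \<Rightarrow> real) set"
  assumes ne: "F \<noteq> {}" and meas: "F \<subseteq> borel_measurable M"
    and b: "b \<in> borel_measurable M" and low: "\<And>f. f \<in> F \<Longrightarrow> AE w in M. b w \<le> f w"
  obtains h t where "h \<in> borel_measurable M" "range t \<subseteq> F"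
    "\<And>g. g \<in> F \<Longrightarrow> AE w in M. h w \<le> g w"
    "AE w in M. \<forall>e>0. \<exists>n::nat. t n w < h w + e"
proof -
  let ?aF = "(\<lambda>f w. arctan (f w)) ` F"
  have aF: "?aF \<noteq> {}" "?aF \<subseteq> borel_measurable M"
    using ne meas by auto
  have bounded: "\<forall>f\<in>?aF. \<forall>w. - (pi / 2) \<le> f w \<and> f w \<le> pi / 2"
    using arctan_bounded less_imp_le by fast
  obtain s :: "nat \<Rightarrow> 'a \<Rightarrow> real" where s: "range s \<subseteq> ?aF" "\<And>g. g \<in> ?aF \<Longrightarrow> AE w in M. (INF n. s n w) \<le> g w"
    using countable_infimum_attains[OF aF bounded] by metis
  then have "\<forall>n. \<exists>f\<in>F. s n = (\<lambda>w. arctan (f w))" by auto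
  then obtain t where t: "\<And>n. t n \<in> F" "\<And>n. s n = (\<lambda>w. arctan (t n w))" by metis
  \<comment> \<open>The maximum changes \<open>t n\<close> only on a null set; it makes the infimum well behaved at every
      point, so that \<open>h\<close> is measurable.\<close>
  define h where "h w = (INF n. max (t n w) (b w))" for w
  have bdd: "bdd_below (range (\<lambda>n. max (t n w) (b w)))" for w
    by (rule bdd_belowI[of _ "b w"]) auto
  have bt: "AE w in M. \<forall>n. b w \<le> t n w"
    using low t(1) by (simp add: AE_all_countable)
  show ?thesis
  proof (rule that)
    show "h \<in> borel_measurable M"
      unfolding h_def using meas t(1) b
      by (intro borel_measurable_cINF_real borel_measurable_max) auto
    show "range t \<subseteq> F" using t(1) by auto
    show "AE w in M. \<forall>e>0. \<exists>n. t n w < h w + e"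
      using bt
    proof eventually_elim
      case (elim w)
      show ?case
      proof (intro allI impI)
        fix e :: real assume "0 < e"
        then have "(INF n. max (t n w) (b w)) < h w + e" by (simp add: h_def)
        then show "\<exists>n. t n w < h w + e" by (subst (asm) cINF_less_iff) (auto intro: bdd)
      qed
    qed
    fix g assume g: "g \<in> F"
    then have "AE w in M. (INF n. arctan (t n w)) \<le> arctan (g w)"
      using s(2)[of "\<lambda>w. arctan (g w)"] by (auto simp: t(2))
    with bt show "AE w in M. h w \<le> g w"
    proof eventually_elim
      case (elim w)
      show ?case
      proof (rule ccontr)
        assume "\<not> h w \<le> g w"
        then have *: "arctan (g w) < arctan (h w)" by (simp add: arctan_less_iff)
        have "h w \<le> t n w" for n
          using cINF_lower[OF bdd, of n w] elim(1) by (simp add: h_def max_def split: if_splits) (metis order_antisym)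
        then have "arctan (h w) \<le> (INF n. arctan (t n w))"
          by (intro cINF_greatest) (auto simp: arctan_le_iff)
        with * elim(2) show False by linarith
      qed
    qed
  qed
qed

section \<open>A sandwich theorem for random seminorms on abelian groups\<close>

text \<open>Only the additive group underlying a module enters the extension argument, with homogeneity of the
seminorm restricted to natural multiples. Random variables are represented by measurable functions and
compared almost everywhere, which makes the inequalities accessible to real arithmetic.\<close>

locale L0_seminormed_group = prob_space M + abelian_group E
  for M :: "'w measure" and E :: "('e, 'x) ring_scheme" (structure) +
  fixes N :: "'e \<Rightarrow> 'w \<Rightarrow> real"
  assumes N_measurable [measurable]: "y \<in> carrier E \<Longrightarrow> N y \<in> borel_measurable M"
    and N_triangle: "\<lbrakk>y \<in> carrier E; z \<in> carrier E\<rbrakk> \<Longrightarrow> AE w in M. N (y \<oplus> z) w \<le> N y w + N z w"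
    and N_minus: "y \<in> carrier E \<Longrightarrow> AE w in M. N (\<ominus> y) w = N y w"
    and N_multiple: "y \<in> carrier E \<Longrightarrow> AE w in M. N (add_pow E (k::nat) y) w = real k * N y w"
begin

abbreviation multiple :: "nat \<Rightarrow> 'e \<Rightarrow> 'e" (infixr "\<star>" 75)
  where "k \<star> y \<equiv> add_pow E k y"

text \<open>A pair \<open>(u, c)\<close> records the constraint that the functional to be constructed should be at
least \<open>c\<close> at \<open>u\<close>. If both \<open>(u, c)\<close> and its negative belong to the cone, the value at
\<open>u\<close> is determined; hence subspaces with a functional on them and one-sided constraints are treated
alike, and chains of cones have their union as an upper bound.\<close>

definition dominated_cone :: "('e \<times> ('w \<Rightarrow> real)) set \<Rightarrow> bool" where
  "dominated_cone D \<longleftrightarrow> D \<subseteq> carrier E \<times> borel_measurable M \<and> (\<zero>, \<lambda>_. 0) \<in> D \<and>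
     (\<forall>(u, c)\<in>D. \<forall>(v, d)\<in>D. (u \<oplus> v, \<lambda>w. c w + d w) \<in> D) \<and>
     (\<forall>(u, c)\<in>D. AE w in M. c w \<le> N u w)"

lemma dominated_coneD:
  assumes "dominated_cone D"
  shows "(u, c) \<in> D \<Longrightarrow> u \<in> carrier E" "(u, c) \<in> D \<Longrightarrow> c \<in> borel_measurable M"
    "(\<zero>, \<lambda>_. 0) \<in> D" "\<lbrakk>(u, c) \<in> D; (v, d) \<in> D\<rbrakk> \<Longrightarrow> (u \<oplus> v, \<lambda>w. c w + d w) \<in> D"
    "(u, c) \<in> D \<Longrightarrow> AE w in M. c w \<le> N u w"
  using assms unfolding dominated_cone_def by fast+

lemma dominated_cone_multiple:
  assumes D: "dominated_cone D" and uc: "(u, c) \<in> D"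
  shows "(k \<star> u, \<lambda>w. real k * c w) \<in> D"
proof (induction k)
  case 0
  then show ?case using dominated_coneD(3)[OF D] by simp
next
  case (Suc k)
  from dominated_coneD(4)[OF D this uc] show ?case
    using dominated_coneD(1)[OF D uc] by (simp add: algebra_simps)
qed

lemma dominated_cone_extend:
  assumes D: "dominated_cone D" and y: "y \<in> carrier E" and c: "c \<in> borel_measurable M"
    and dom: "\<And>u d k. (u, d) \<in> D \<Longrightarrow>
      AE w in M. d w + real k * c w \<le> N (u \<oplus> k \<star> y) w"
  obtains D' where "dominated_cone D'" "D \<subseteq> D'" "(y, c) \<in> D'"
proof
  define D' where "D' = {(u \<oplus> k \<star> y, \<lambda>w. d w + real k * c w) |u d k. (u, d) \<in> D}"
  have D'I: "(u', d') \<in> D'" if "(u, d) \<in> D" "u' = u \<oplus> k \<star> y"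
    "d' = (\<lambda>w. d w + real k * c w)" for u d k u' d'
    using that by (auto simp: D'_def)
  show sub: "D \<subseteq> D'"
    
  proof
    fix p assume p: "p \<in> D"
    then have "(fst p, snd p) \<in> D" by simp
    from D'I[OF this, of "fst p" 0 "snd p"] dominated_coneD(1)[OF D this]
    show "p \<in> D'" by simp
  qed
  show "(y, c) \<in> D'"
    using D'I[OF dominated_coneD(3)[OF D], of y 1 c] y by simp
  show "dominated_cone D'"
    unfolding dominated_cone_def
  proof (intro conjI)
    show "D' \<subseteq> carrier E \<times> borel_measurable M"
      using dominated_coneD(1,2)[OF D] c y by (auto simp: D'_def)
    show "(\<zero>, \<lambda>_. 0) \<in> D'" using sub dominated_coneD(3)[OF D] by blast
    show "\<forall>(u, c)\<in>D'. AE w in M. c w \<le> N u w"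
      using dom by (auto simp: D'_def)
    have "(u \<oplus> k \<star> y \<oplus> (v \<oplus> l \<star> y), \<lambda>w. d w + real k * c w + (e w + real l * c w)) \<in> D'"
      if "(u, d) \<in> D" "(v, e) \<in> D" for u v d e and k l :: nat
    proof (rule D'I[of "u \<oplus> v" "\<lambda>w. d w + e w" _ "k + l", OF dominated_coneD(4)[OF D that]])
      have "u \<in> carrier E" "v \<in> carrier E" using dominated_coneD(1)[OF D] that by auto
      then show "u \<oplus> k \<star> y \<oplus> (v \<oplus> l \<star> y) = u \<oplus> v \<oplus> (k + l) \<star> y"
        using y by (simp add: add.nat_pow_mult[symmetric] a_ac)
    qed (auto simp: algebra_simps)
    then show "\<forall>(u, c)\<in>D'. \<forall>(v, d)\<in>D'. (u \<oplus> v, \<lambda>w. c w + d w) \<in> D'"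
      unfolding D'_def by fast
  qed
qed

text \<open>Multiplying the two pairs by \<open>Suc l\<close> and \<open>Suc k\<close> makes the multiples of \<open>y\<close> cancel
in their sum; what remains is an element of the cone, and domination of this element together with
the triangle inequality is the claim. It says that each lower bound on an admissible value at
\<open>y\<close> is below each upper bound.\<close>

lemma dominated_cone_gap:
  assumes D: "dominated_cone D" and y: "y \<in> carrier E"
    and ud: "(u, d) \<in> D" and ve: "(v, e) \<in> D"
  shows "AE w in M. (e w - N (v \<oplus> (Suc l) \<star> \<ominus> y) w) / real (Suc l)
                  \<le> (N (u \<oplus> (Suc k) \<star> y) w - d w) / real (Suc k)"
proof -
  have [simp]: "u \<in> carrier E" "v \<in> carrier E" using dominated_coneD(1)[OF D] ud ve by auto
  define p where "p = v \<oplus> (Suc l) \<star> \<ominus> y"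
  define q where "q = u \<oplus> (Suc k) \<star> y"
  have pq: "p \<in> carrier E" "q \<in> carrier E"
    unfolding p_def q_def using y by (auto simp del: add.nat_pow_Suc)
  have "(Suc k) \<star> p = (Suc k) \<star> v \<oplus> \<ominus> ((Suc k * Suc l) \<star> y)"
    unfolding p_def using y
    by (simp add: add.nat_pow_distrib add.nat_pow_pow add.nat_pow_inv mult.commute
        del: add.nat_pow_Suc mult_Suc mult_Suc_right)
  moreover have "(Suc l) \<star> q = (Suc l) \<star> u \<oplus> (Suc k * Suc l) \<star> y"
    unfolding q_def using y
    by (simp add: add.nat_pow_distrib add.nat_pow_pow mult.commute
        del: add.nat_pow_Suc mult_Suc mult_Suc_right)
  moreover have "a \<oplus> \<ominus> z \<oplus> (b \<oplus> z) = a \<oplus> b"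
    if "a \<in> carrier E" "b \<in> carrier E" "z \<in> carrier E" for a b z
    using that by (simp add: a_ac r_neg1 r_neg2 r_neg)
  ultimately have sum: "(Suc k) \<star> p \<oplus> (Suc l) \<star> q = (Suc k) \<star> v \<oplus> (Suc l) \<star> u"
    using y by (simp del: add.nat_pow_Suc mult_Suc mult_Suc_right)
  have "((Suc k) \<star> v \<oplus> (Suc l) \<star> u, \<lambda>w. real (Suc k) * e w + real (Suc l) * d w) \<in> D"
    by (intro dominated_coneD(4)[OF D] dominated_cone_multiple[OF D] ud ve)
  note cone = dominated_coneD(5)[OF D this]
  have "AE w in M. N ((Suc k) \<star> v \<oplus> (Suc l) \<star> u) w \<le> N (Suc k \<star> p) w + N (Suc l \<star> q) w"
    unfolding sum[symmetric] by (rule N_triangle) (use pq in auto)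
  with cone N_multiple[OF pq(1), of "Suc k"] N_multiple[OF pq(2), of "Suc l"]
  have "AE w in M. real (Suc k) * e w + real (Suc l) * d w
                 \<le> real (Suc k) * N p w + real (Suc l) * N q w"
    by eventually_elim linarith
  then show ?thesis
    unfolding p_def[symmetric] q_def[symmetric]
  proof eventually_elim
    case (elim w)
    then have "(e w - N p w) * real (Suc k) \<le> (N q w - d w) * real (Suc l)"
      by (simp add: algebra_simps del: of_nat_Suc)
    then show ?case
      by (simp add: divide_le_eq le_divide_eq mult.commute del: of_nat_Suc)
  qed
qed

text \<open>The one-step extension of the Hahn-Banach theorem. The essential infimum \<open>c\<close> of all upper bounds on
the value at \<open>y\<close> also respects all lower bounds. Thus the constraints \<open>(y, c)\<close> and
\<open>(\<ominus> y, - c)\<close> can both be added to the cone, and by maximality they are already in it.\<close>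

lemma maximal_dominated_cone_value:
  assumes D: "dominated_cone D" and max: "\<And>D'. dominated_cone D' \<Longrightarrow> D \<subseteq> D' \<Longrightarrow> D' = D"
    and y: "y \<in> carrier E"
  obtains c where "(y, c) \<in> D" "(\<ominus> y, \<lambda>w. - c w) \<in> D"
proof -
  define F where "F = {\<lambda>w. (N (u \<oplus> (Suc k) \<star> y) w - d w) / real (Suc k) |u d k. (u, d) \<in> D}"
  have closed: "u \<oplus> (Suc k) \<star> y \<in> carrier E" if "(u, d) \<in> D" for u d k
    using dominated_coneD(1)[OF D that] y by simp
  have FI: "(\<lambda>w. (N (u \<oplus> (Suc k) \<star> y) w - d w) / real (Suc k)) \<in> F" if "(u, d) \<in> D" for u d k
    using that unfolding F_def by blast
  have gap: "AE w in M. (e w - N (v \<oplus> (Suc l) \<star> \<ominus> y) w) / real (Suc l) \<le> g w"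
    if "g \<in> F" "(v, e) \<in> D" for g v e l
  proof -
    from that(1) obtain u d k where ud: "(u, d) \<in> D"
      and g: "g = (\<lambda>w. (N (u \<oplus> Suc k \<star> y) w - d w) / real (Suc k))"
      unfolding F_def by blast
    show ?thesis unfolding g by (rule dominated_cone_gap[OF D y ud that(2)])
  qed
  have F: "F \<noteq> {}" "F \<subseteq> borel_measurable M"
  proof -
    show "F \<noteq> {}" using FI[OF dominated_coneD(3)[OF D], of 0] by blast
    show "F \<subseteq> borel_measurable M"
    proof
      fix g assume "g \<in> F"
      then obtain u d k where g: "g = (\<lambda>w. (N (u \<oplus> Suc k \<star> y) w - d w) / real (Suc k))"
        and ud: "(u, d) \<in> D" unfolding F_def by blast
      note [measurable] = N_measurable[OF closed[OF ud]] dominated_coneD(2)[OF D ud]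
      show "g \<in> borel_measurable M" unfolding g by measurable
    qed
  qed
  \<comment> \<open>The trivial lower bound \<open>- N (\<ominus> y)\<close>, in the form in which the gap lemma yields it
      for the zero pair.\<close>
  have low_meas: "(\<lambda>w. (0 - N (\<zero> \<oplus> (Suc 0) \<star> \<ominus> y) w) / real (Suc 0)) \<in> borel_measurable M"
    using y by simp
  obtain c t where c: "c \<in> borel_measurable M" "range t \<subseteq> F"
    "\<And>g. g \<in> F \<Longrightarrow> AE w in M. c w \<le> g w"
    "AE w in M. \<forall>\<delta>>0. \<exists>n::nat. t n w < c w + \<delta>"
  proof (rule essential_infimum[OF F low_meas])
    fix g assume "g \<in> F"
    from gap[OF this dominated_coneD(3)[OF D], of 0]
    show "AE w in M. (0 - N (\<zero> \<oplus> Suc 0 \<star> \<ominus> y) w) / real (Suc 0) \<le> g w" .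
  qed (rule that)
  have greatest: "AE w in M. b w \<le> c w" if "\<And>g. g \<in> F \<Longrightarrow> AE w in M. b w \<le> g w" for b
  proof -
    have "AE w in M. \<forall>n. b w \<le> t n w" using that c(2) by (auto simp: AE_all_countable)
    with c(4) show ?thesis
    proof eventually_elim
      case (elim w)
      show ?case
      proof (rule field_le_epsilon)
        fix \<delta> :: real assume "0 < \<delta>"
        with elim obtain n where "b w \<le> t n w" "t n w < c w + \<delta>" by blast
        then show "b w \<le> c w + \<delta>" by linarith
      qed
    qed
  qed
  have in_D: "(z, a) \<in> D" if z: "z \<in> carrier E" and a: "a \<in> borel_measurable M"
    and dom: "\<And>u d k. (u, d) \<in> D \<Longrightarrow>
      AE w in M. d w + real (Suc k) * a w \<le> N (u \<oplus> Suc k \<star> z) w" for z a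
  proof -
    have "AE w in M. d w + real k * a w \<le> N (u \<oplus> k \<star> z) w" if ud: "(u, d) \<in> D" for u d k
    proof (cases k)
      case 0
      then show ?thesis using dominated_coneD(5,1)[OF D ud] by simp
    next
      case (Suc k')
      show ?thesis unfolding Suc by (rule dom[OF ud])
    qed
    then obtain D' where D': "dominated_cone D'" "D \<subseteq> D'" "(z, a) \<in> D'"
      by (rule dominated_cone_extend[OF D z a])
    then show ?thesis using max[OF D'(1,2)] by simp
  qed
  show ?thesis
  proof (rule that)
    show "(y, c) \<in> D"
    proof (rule in_D[OF y c(1)])
      fix u d k assume "(u, d) \<in> D"
      from c(3)[OF FI[OF this, of k]]
      show "AE w in M. d w + real (Suc k) * c w \<le> N (u \<oplus> (Suc k) \<star> y) w"
        by eventually_elim (simp add: le_divide_eq algebra_simps del: of_nat_Suc add.nat_pow_Suc)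
    qed
    show "(\<ominus> y, \<lambda>w. - c w) \<in> D"
    proof (rule in_D)
      fix u d k assume ud: "(u, d) \<in> D"
      have "AE w in M. (d w - N (u \<oplus> Suc k \<star> \<ominus> y) w) / real (Suc k) \<le> c w"
        by (rule greatest, rule gap[OF _ ud])
      then show "AE w in M. d w + real (Suc k) * - c w \<le> N (u \<oplus> (Suc k) \<star> \<ominus> y) w"
        by eventually_elim (simp add: divide_le_eq algebra_simps del: of_nat_Suc add.nat_pow_Suc)
    qed (use y c(1) in auto)
  qed
qed

text \<open>A Hahn-Banach sandwich theorem with values in the random variables. By Zorn's lemma the given cone
lies in a maximal one, which determines a value at every point. Two values at the same point
agree because their difference is a constraint at zero, where the seminorm vanishes; this
uniqueness yields additivity.\<close>

theorem dominating_additive_map: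
  assumes D0: "dominated_cone D0"
  obtains f where "\<And>y. y \<in> carrier E \<Longrightarrow> f y \<in> borel_measurable M"
    "\<And>y z. \<lbrakk>y \<in> carrier E; z \<in> carrier E\<rbrakk> \<Longrightarrow> AE w in M. f (y \<oplus> z) w = f y w + f z w"
    "\<And>y. y \<in> carrier E \<Longrightarrow> AE w in M. \<bar>f y w\<bar> \<le> N y w"
    "\<And>u c. (u, c) \<in> D0 \<Longrightarrow> AE w in M. c w \<le> f u w"
proof -
  have "\<exists>D\<in>{D. dominated_cone D \<and> D0 \<subseteq> D}. \<forall>D'\<in>{D. dominated_cone D \<and> D0 \<subseteq> D}.
          D \<subseteq> D' \<longrightarrow> D' = D"
  proof (rule subset_Zorn_nonempty)
    show "{D. dominated_cone D \<and> D0 \<subseteq> D} \<noteq> {}" using D0 by blast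
    fix C assume ne: "C \<noteq> {}" and C: "subset.chain {D. dominated_cone D \<and> D0 \<subseteq> D} C"
    then have cone: "\<And>D. D \<in> C \<Longrightarrow> dominated_cone D" "\<And>D. D \<in> C \<Longrightarrow> D0 \<subseteq> D"
      and total: "\<And>D D'. \<lbrakk>D \<in> C; D' \<in> C\<rbrakk> \<Longrightarrow> D \<subseteq> D' \<or> D' \<subseteq> D"
      by (auto simp: subset_chain_def)
    have "dominated_cone (\<Union>C)"
      unfolding dominated_cone_def
    proof (intro conjI)
      show "\<Union>C \<subseteq> carrier E \<times> borel_measurable M"
        using dominated_coneD(1,2)[OF cone(1)] by auto
      show "(\<zero>, \<lambda>_. 0) \<in> \<Union>C" using ne dominated_coneD(3)[OF cone(1)] by blast
      show "\<forall>(u, c)\<in>\<Union>C. AE w in M. c w \<le> N u w"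
        using dominated_coneD(5)[OF cone(1)] by auto
      have "(u \<oplus> v, \<lambda>w. c w + d w) \<in> \<Union>C"
        if uv: "(u, c) \<in> D" "D \<in> C" "(v, d) \<in> D'" "D' \<in> C" for u v c d D D'
      proof -
        obtain D'' where "D'' \<in> C" "(u, c) \<in> D''" "(v, d) \<in> D''"
          using total[OF uv(2,4)] uv by blast
        then show ?thesis using dominated_coneD(4)[OF cone(1)] by blast
      qed
      then show "\<forall>(u, c)\<in>\<Union>C. \<forall>(v, d)\<in>\<Union>C. (u \<oplus> v, \<lambda>w. c w + d w) \<in> \<Union>C"
        by blast
    qed
    then show "\<Union>C \<in> {D. dominated_cone D \<and> D0 \<subseteq> D}" using ne cone(2) by blast
  qed
  then obtain D where D: "dominated_cone D" "D0 \<subseteq> D"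
    and max: "\<And>D'. dominated_cone D' \<Longrightarrow> D \<subseteq> D' \<Longrightarrow> D' = D"
    by (auto 0 4)
  have "\<forall>y\<in>carrier E. \<exists>c. (y, c) \<in> D \<and> (\<ominus> y, \<lambda>w. - c w) \<in> D"
    using maximal_dominated_cone_value[OF D(1) max] by metis
  then obtain f where f: "\<And>y. y \<in> carrier E \<Longrightarrow> (y, f y) \<in> D"
    "\<And>y. y \<in> carrier E \<Longrightarrow> (\<ominus> y, \<lambda>w. - f y w) \<in> D"
    by metis
  \<comment> \<open>The difference of two constraints at the same point is a constraint at zero.\<close>
  have below: "AE w in M. c w \<le> f u w" if uc: "(u, c) \<in> D" for u c
  proof -
    have u: "u \<in> carrier E" by (rule dominated_coneD(1)[OF D(1) uc])
    have "(\<zero>, \<lambda>w. c w - f u w) \<in> D"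
      using dominated_coneD(4)[OF D(1) uc f(2)[OF u]] u by (simp add: r_neg)
    from dominated_coneD(5)[OF D(1) this] N_multiple[OF zero_closed, of 0]
    show ?thesis by eventually_elim simp
  qed
  show ?thesis
  proof (rule that)
    fix y assume y: "y \<in> carrier E"
    show "f y \<in> borel_measurable M" by (rule dominated_coneD(2)[OF D(1) f(1)[OF y]])
    from dominated_coneD(5)[OF D(1) f(1)[OF y]] dominated_coneD(5)[OF D(1) f(2)[OF y]] N_minus[OF y]
    show "AE w in M. \<bar>f y w\<bar> \<le> N y w" by eventually_elim simp
    fix z assume z: "z \<in> carrier E"
    have "AE w in M. f y w + f z w \<le> f (y \<oplus> z) w"
      by (intro below dominated_coneD(4)[OF D(1)] f y z)
    moreover have "(\<zero>, \<lambda>w. f (y \<oplus> z) w + (- f y w + - f z w)) \<in> D"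
      using dominated_coneD(4)[OF D(1) f(1)[of "y \<oplus> z"]
          dominated_coneD(4)[OF D(1) f(2)[OF y] f(2)[OF z]]] y z
      by (simp add: minus_add[symmetric] r_neg)
    from dominated_coneD(5)[OF D(1) this] N_multiple[OF zero_closed, of 0]
    have "AE w in M. f (y \<oplus> z) w \<le> f y w + f z w" by eventually_elim simp
    ultimately show "AE w in M. f (y \<oplus> z) w = f y w + f z w" by eventually_elim simp
  qed (use below D(2) in blast)
qed

end

section \<open>Seminormed modules through representatives\<close>

lemma L0_class_eq_iff:
  assumes "f \<in> borel_measurable M" "g \<in> borel_measurable M"
  shows "L0_class M f = L0_class M g \<longleftrightarrow> (AE w in M. f w = g w)"
proof
  assume "L0_class M f = L0_class M g"
  moreover have "f \<in> L0_class M f" using assms(1) by (simp add: L0_class_eq)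
  ultimately have "f \<in> L0_class M g" by simp
  then show "AE w in M. f w = g w" using assms by (simp add: L0_class_eq)
next
  assume "AE w in M. f w = g w"
  then have "(AE w in M. h w = f w) \<longleftrightarrow> (AE w in M. h w = g w)" for h :: "'a \<Rightarrow> real"
    by (intro eventually_cong) auto
  then show "L0_class M f = L0_class M g" using assms by (simp add: L0_class_eq)
qed

lemma L0_class_in_carrier [simp, intro]: "f \<in> borel_measurable M \<Longrightarrow> L0_class M f \<in> carrier (L0 M)"
  by (simp add: carrier_L0)

locale L0_seminormed_module = prob_space M + Module.module "L0 M" E
  for M :: "'w measure" and E :: "(('w \<Rightarrow> real) set, 'e) module" (structure) +
  fixes nrm :: "'e \<Rightarrow> ('w \<Rightarrow> real) set"
  assumes seminorm: "L0_seminorm M E nrm"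
begin

abbreviation cls :: "('w \<Rightarrow> real) \<Rightarrow> ('w \<Rightarrow> real) set" where "cls \<equiv> L0_class M"

definition N :: "'e \<Rightarrow> 'w \<Rightarrow> real" where
  "N y = (SOME f. f \<in> borel_measurable M \<and> nrm y = cls f)"

lemma
  assumes y: "y \<in> carrier E"
  shows N_measurable [measurable]: "N y \<in> borel_measurable M" and nrm_eq: "nrm y = cls (N y)"
proof -
  have "nrm y \<in> carrier (L0 M)" using seminorm y by (auto simp: L0_seminorm_def L0_plus_def)
  then have "\<exists>f. f \<in> borel_measurable M \<and> nrm y = cls f" by (auto simp: carrier_L0)
  from someI_ex[OF this] show "N y \<in> borel_measurable M" "nrm y = cls (N y)"
    unfolding N_def by auto
qed

lemma nrm_le_iff:
  assumes "y \<in> carrier E" "e \<in> borel_measurable M"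
  shows "L0_le M (nrm y) (cls e) \<longleftrightarrow> (AE w in M. N y w \<le> e w)"
  using assms by (simp add: nrm_eq L0_le_class N_measurable)

lemma N_nonneg:
  assumes y: "y \<in> carrier E"
  shows "AE w in M. 0 \<le> N y w"
proof -
  have "L0_le M \<zero>\<^bsub>L0 M\<^esub> (nrm y)" using seminorm y by (auto simp: L0_seminorm_def L0_plus_def)
  then show ?thesis using y by (simp add: nrm_eq zero_L0 L0_le_class N_measurable)
qed

lemma N_smult:
  assumes y: "y \<in> carrier E" and g: "g \<in> borel_measurable M"
  shows "AE w in M. N (cls g \<odot> y) w = \<bar>g w\<bar> * N y w"
proof -
  have "nrm (cls g \<odot> y) = L0_abs M (cls g) \<otimes>\<^bsub>L0 M\<^esub> nrm y"
    using seminorm y g by (auto simp: L0_seminorm_def)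
  moreover have "cls g \<odot> y \<in> carrier E" using y g by simp
  ultimately have "cls (N (cls g \<odot> y)) = cls (\<lambda>w. \<bar>g w\<bar> * N y w)"
    using y g by (simp add: nrm_eq L0_abs_class mult_L0 N_measurable)
  then show ?thesis
    using y g by (subst (asm) L0_class_eq_iff) (auto intro!: N_measurable borel_measurable_times)
qed

lemma N_add:
  assumes "y \<in> carrier E" "z \<in> carrier E"
  shows "AE w in M. N (y \<oplus> z) w \<le> N y w + N z w"
proof -
  have "L0_le M (nrm (y \<oplus> z)) (nrm y \<oplus>\<^bsub>L0 M\<^esub> nrm z)"
    using seminorm assms by (auto simp: L0_seminorm_def)
  then show ?thesis using assms by (simp add: nrm_eq L0_le_class add_L0 N_measurable)
qed

lemma cls_add_smult:
  assumes "y \<in> carrier E" "f \<in> borel_measurable M" "g \<in> borel_measurable M"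
  shows "cls f \<odot> y \<oplus> cls g \<odot> y = cls (\<lambda>w. f w + g w) \<odot> y"
  using assms by (simp add: smult_l_distr[symmetric] add_L0)

lemma cls_mult_smult:
  assumes "y \<in> carrier E" "f \<in> borel_measurable M" "g \<in> borel_measurable M"
  shows "cls f \<odot> (cls g \<odot> y) = cls (\<lambda>w. f w * g w) \<odot> y"
  using assms by (simp add: smult_assoc1[symmetric] mult_L0)

lemma cls_one_smult: "y \<in> carrier E \<Longrightarrow> cls (\<lambda>_. 1) \<odot> y = y"
  using smult_one[of y] by (simp add: one_L0)

lemma cls_zero_smult: "y \<in> carrier E \<Longrightarrow> cls (\<lambda>_. 0) \<odot> y = \<zero>"
  using smult_l_null[of y] by (simp add: zero_L0)

lemma cls_uminus_smult:
  assumes "y \<in> carrier E" "g \<in> borel_measurable M"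
  shows "cls (\<lambda>w. - g w) \<odot> y = \<ominus> (cls g \<odot> y)"
proof (rule M.minus_equality[symmetric])
  show "cls (\<lambda>w. - g w) \<odot> y \<oplus> cls g \<odot> y = \<zero>"
    using assms by (simp add: cls_add_smult cls_zero_smult)
qed (use assms in auto)

lemma multiple_eq_smult:
  assumes y: "y \<in> carrier E"
  shows "add_pow E (k::nat) y = cls (\<lambda>_. real k) \<odot> y"
proof (induction k)
  case 0
  then show ?case using y by (simp add: cls_zero_smult)
next
  case (Suc k)
  have "cls (\<lambda>_. real k) \<odot> y \<oplus> y = cls (\<lambda>_. real k) \<odot> y \<oplus> cls (\<lambda>_. 1) \<odot> y"
    using y by (simp add: cls_one_smult)
  also have "\<dots> = cls (\<lambda>_. real (Suc k)) \<odot> y"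
    using y by (simp add: cls_add_smult add.commute)
  finally show ?case using Suc by simp
qed

sublocale seminormed_group: L0_seminormed_group M E N
proof unfold_locales
  fix y assume y: "y \<in> carrier E"
  show "N y \<in> borel_measurable M" by (rule N_measurable[OF y])
  show "AE w in M. N (add_pow E k y) w = real k * N y w" for k :: nat
    using N_smult[OF y, of "\<lambda>_. real k"] by (simp add: multiple_eq_smult[OF y])
  have "\<ominus> y = cls (\<lambda>_. - 1) \<odot> y"
    using cls_uminus_smult[OF y, of "\<lambda>_. 1"] y by (simp add: cls_one_smult)
  then show "AE w in M. N (\<ominus> y) w = N y w"
    using N_smult[OF y, of "\<lambda>_. - 1"] by simp
qed (rule N_add)

section \<open>Bounded additive maps are linear and continuous\<close>

context
  fixes f :: "'e \<Rightarrow> 'w \<Rightarrow> real"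
  assumes f_meas: "\<And>y. y \<in> carrier E \<Longrightarrow> f y \<in> borel_measurable M"
    and f_add: "\<And>y z. \<lbrakk>y \<in> carrier E; z \<in> carrier E\<rbrakk> \<Longrightarrow> AE w in M. f (y \<oplus> z) w = f y w + f z w"
    and f_le: "\<And>y. y \<in> carrier E \<Longrightarrow> AE w in M. \<bar>f y w\<bar> \<le> N y w"
begin

lemma additive_zero: "AE w in M. f \<zero> w = 0"
  using f_add[of \<zero> \<zero>] by simp

lemma additive_minus:
  assumes y: "y \<in> carrier E"
  shows "AE w in M. f (\<ominus> y) w = - f y w"
  using f_add[OF y M.a_inv_closed[OF y]] additive_zero
  by eventually_elim (simp add: M.r_neg y)

lemma additive_multiple:
  assumes y: "y \<in> carrier E"
  shows "AE w in M. f (add_pow E (k::nat) y) w = real k * f y w"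
proof (induction k)
  case 0
  then show ?case using additive_zero by simp
next
  case (Suc k)
  have "AE w in M. f (add_pow E k y \<oplus> y) w = f (add_pow E k y) w + f y w"
    using y by (intro f_add) auto
  with Suc show ?case by eventually_elim (simp add: algebra_simps)
qed

lemma additive_int_multiple:
  assumes y: "y \<in> carrier E"
  shows "AE w in M. f (cls (\<lambda>_. real_of_int k) \<odot> y) w = real_of_int k * f y w"
proof (cases "0 \<le> k")
  case True
  then show ?thesis
    using additive_multiple[OF y, of "nat k"] by (simp add: multiple_eq_smult[OF y])
next
  case False
  have "cls (\<lambda>_. real_of_int k) \<odot> y = \<ominus> (add_pow E (nat (- k)) y)"
    using False cls_uminus_smult[OF y, of "\<lambda>_. real (nat (- k))"]
    by (simp add: multiple_eq_smult[OF y])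
  moreover
  have "AE w in M. f (\<ominus> (add_pow E (nat (- k)) y)) w = - f (add_pow E (nat (- k)) y) w"
    using y by (intro additive_minus) auto
  with additive_multiple[OF y, of "nat (- k)"]
  have "AE w in M. f (\<ominus> (add_pow E (nat (- k)) y)) w = real_of_int k * f y w"
    by eventually_elim (use False in simp)
  ultimately show ?thesis by simp
qed

text \<open>For integers \<open>n\<close> and \<open>k\<close>, additivity and the bound on \<open>f\<close> give
\<open>\<bar>n f (g y) - k f y\<bar> \<le> \<bar>n g - k\<bar> N y\<close> almost surely. As there are only countably many such pairs, one may
choose \<open>k\<close> at each point \<open>w\<close> separately, namely as the integer part of \<open>n g w\<close>. This yields
\<open>n \<bar>f (g y) - g f y\<bar> \<le> 2 N y\<close> for all \<open>n\<close>.\<close>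

lemma additive_smult:
  assumes y: "y \<in> carrier E" and g: "g \<in> borel_measurable M"
  shows "AE w in M. f (cls g \<odot> y) w = g w * f y w"
proof -
  have gy: "cls g \<odot> y \<in> carrier E" using y g by simp
  have step: "AE w in M. \<bar>real n * f (cls g \<odot> y) w - real_of_int k * f y w\<bar>
                    \<le> \<bar>real n * g w - real_of_int k\<bar> * N y w" for n :: nat and k :: int
  proof -
    have diff: "add_pow E n (cls g \<odot> y) \<oplus> cls (\<lambda>_. real_of_int (- k)) \<odot> y
        = cls (\<lambda>w. real n * g w - real_of_int k) \<odot> y"
      using y g gy by (simp add: multiple_eq_smult cls_mult_smult cls_add_smult)
    have "AE w in M. f (cls (\<lambda>w. real n * g w - real_of_int k) \<odot> y) w
        = f (add_pow E n (cls g \<odot> y)) w + f (cls (\<lambda>_. real_of_int (- k)) \<odot> y) w"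
      unfolding diff[symmetric] using y g gy by (intro f_add) auto
    moreover note additive_multiple[OF gy, of n] additive_int_multiple[OF y, of "- k"]
    moreover have "AE w in M. \<bar>f (cls (\<lambda>w. real n * g w - real_of_int k) \<odot> y) w\<bar>
        \<le> N (cls (\<lambda>w. real n * g w - real_of_int k) \<odot> y) w"
      using y g by (intro f_le) auto
    moreover have "AE w in M. N (cls (\<lambda>w. real n * g w - real_of_int k) \<odot> y) w
        = \<bar>real n * g w - real_of_int k\<bar> * N y w"
      using y g by (intro N_smult) auto
    ultimately show ?thesis by eventually_elim simp
  qed
  have "AE w in M. \<forall>n k. \<bar>real n * f (cls g \<odot> y) w - real_of_int k * f y w\<bar>
                    \<le> \<bar>real n * g w - real_of_int k\<bar> * N y w"
    unfolding AE_all_countable using step by blast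
  with f_le[OF y] show ?thesis
  proof eventually_elim
    case (elim w)
    have "real n * \<bar>f (cls g \<odot> y) w - g w * f y w\<bar> \<le> 2 * N y w" for n
    proof -
      define k where "k = \<lfloor>real n * g w\<rfloor>"
      have k: "\<bar>real n * g w - real_of_int k\<bar> \<le> 1" unfolding k_def by linarith
      have nn: "0 \<le> N y w" using elim(1) by linarith
      have "real n * (f (cls g \<odot> y) w - g w * f y w)
          = (real n * f (cls g \<odot> y) w - real_of_int k * f y w)
            - (real n * g w - real_of_int k) * f y w" by (simp add: algebra_simps)
      then have "real n * \<bar>f (cls g \<odot> y) w - g w * f y w\<bar>
          \<le> \<bar>real n * f (cls g \<odot> y) w - real_of_int k * f y w\<bar>
            + \<bar>real n * g w - real_of_int k\<bar> * \<bar>f y w\<bar>"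
        using abs_triangle_ineq4[of "real n * f (cls g \<odot> y) w - real_of_int k * f y w"
            "(real n * g w - real_of_int k) * f y w"]
        by (simp add: abs_mult[symmetric])
      also have "\<dots> \<le> \<bar>real n * g w - real_of_int k\<bar> * N y w
            + \<bar>real n * g w - real_of_int k\<bar> * N y w"
        using elim by (intro add_mono mult_left_mono) auto
      also have "\<dots> \<le> 1 * N y w + 1 * N y w"
        using k nn by (intro add_mono mult_right_mono) auto
      finally show ?thesis by simp
    qed
    then have bound: "real n * \<bar>f (cls g \<odot> y) w - g w * f y w\<bar> \<le> 2 * N y w" for n .
    have "\<not> 0 < \<bar>f (cls g \<odot> y) w - g w * f y w\<bar>"
      using reals_Archimedean3[of "\<bar>f (cls g \<odot> y) w - g w * f y w\<bar>"] bound
      by (meson not_le)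
    then show ?case by simp
  qed
qed

lemma additive_in_dual: "(\<lambda>y. cls (f y)) \<in> L0_dual M E nrm"
  unfolding L0_dual_def
proof (intro CollectI conjI ballI)
  show "(\<lambda>y. cls (f y)) \<in> carrier E \<rightarrow> carrier (L0 M)" using f_meas by auto
  show add: "cls (f (y \<oplus> z)) = cls (f y) \<oplus>\<^bsub>L0 M\<^esub> cls (f z)"
    if "y \<in> carrier E" "z \<in> carrier E" for y z
    using that f_add[OF that] f_meas by (simp add: add_L0 L0_class_eq_iff)
  show "cls (f (Y \<odot> y)) = Y \<otimes>\<^bsub>L0 M\<^esub> cls (f y)"
    if "Y \<in> carrier (L0 M)" and y: "y \<in> carrier E" for Y y
  proof -
    from that obtain g where g: "g \<in> borel_measurable M" "Y = cls g" by (auto simp: carrier_L0)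
    have "cls g \<odot> y \<in> carrier E" using g y by simp
    then show ?thesis
      using additive_smult[OF y g(1)] f_meas y g by (simp add: mult_L0 L0_class_eq_iff)
  qed
  show "continuous_map (seminorm_topology M E {nrm}) (L0_topology M) (\<lambda>y. cls (f y))"
    unfolding continuous_map_def
  proof (intro conjI allI impI)
    have tE: "topspace (seminorm_topology M E {nrm}) = carrier E"
      by (rule topspace_seminorm_topology) (rule M.abelian_group_axioms)
    have tL: "topspace (L0_topology M) = carrier (L0 M)"
      unfolding L0_topology_def by (rule topspace_seminorm_topology) (rule R.abelian_group_axioms)
    show "(\<lambda>y. cls (f y)) \<in> topspace (seminorm_topology M E {nrm}) \<rightarrow> topspace (L0_topology M)"
      using f_meas by (auto simp: tE tL)
    fix U assume "openin (L0_topology M) U"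
    then have U: "seminorm_open M (L0 M) {L0_abs M} U"
      by (simp add: L0_topology_def openin_seminorm_topology)
    show "openin (seminorm_topology M E {nrm})
        {y \<in> topspace (seminorm_topology M E {nrm}). cls (f y) \<in> U}"
      unfolding tE openin_seminorm_topology seminorm_open_def
    proof (intro conjI ballI)
      fix y assume "y \<in> {y \<in> carrier E. cls (f y) \<in> U}"
      then have y: "y \<in> carrier E" and fy: "cls (f y) \<in> U" by auto
      from U fy obtain Q e where Q: "Q \<subseteq> {L0_abs M}" and e: "e \<in> L0_pp M"
        and ball: "\<forall>z\<in>L0_ball M (L0 M) Q e. cls (f y) \<oplus>\<^bsub>L0 M\<^esub> z \<in> U"
        unfolding seminorm_open_def by meson
      from e obtain e' where e': "e' \<in> borel_measurable M" "e = cls e'" by (auto simp: L0_pp_iff)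
      have "y \<oplus> z \<in> {y \<in> carrier E. cls (f y) \<in> U}" if z: "z \<in> L0_ball M E {nrm} e" for z
      proof -
        have zE: "z \<in> carrier E" using z by (simp add: L0_ball_def)
        have "AE w in M. N z w \<le> e' w" using z zE by (simp add: L0_ball_def e' nrm_le_iff)
        with f_le[OF zE] have "AE w in M. \<bar>f z w\<bar> \<le> e' w" by eventually_elim simp
        then have "L0_le M (L0_abs M (cls (f z))) e"
          using f_meas[OF zE] e' by (simp add: L0_abs_class L0_le_class)
        then have "cls (f z) \<in> L0_ball M (L0 M) Q e"
          using Q f_meas[OF zE] by (auto simp: L0_ball_def)
        with ball have "cls (f y) \<oplus>\<^bsub>L0 M\<^esub> cls (f z) \<in> U" by blast
        then show ?thesis using add[OF y zE] y zE by simp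
      qed
      with e show "\<exists>Q e. finite Q \<and> Q \<subseteq> {nrm} \<and> e \<in> L0_pp M \<and>
          (\<forall>z\<in>L0_ball M E Q e. y \<oplus> z \<in> {y \<in> carrier E. cls (f y) \<in> U})"
        by (intro exI[of _ "{nrm}"] exI[of _ e]) auto
    qed auto
  qed
qed

end

end

section \<open>Separating a point from a convex hull\<close>

context L0_seminormed_module
begin

text \<open>Sums with repetition. The average of such a sum is a convex combination, and the sums of varying length are closed
under addition, so they turn the convex hull into a cone on which only natural multiples are used.\<close>

definition nfold_sums :: "'e set \<Rightarrow> nat \<Rightarrow> 'e set" where
  "nfold_sums S n = {\<Oplus>\<^bsub>E\<^esub>i\<in>{1..n}. s i |s. \<forall>i\<in>{1..n}. s i \<in> S}"

lemma nfold_sums_closed: "S \<subseteq> carrier E \<Longrightarrow> nfold_sums S n \<subseteq> carrier E"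
  by (auto simp: nfold_sums_def intro!: M.finsum_closed)

lemma nfold_sums_0: "nfold_sums S 0 = {\<zero>}"
  by (auto simp: nfold_sums_def)

lemma finsum_atLeastAtMost_Suc:
  assumes "\<And>i. i \<in> {1..Suc n} \<Longrightarrow> s i \<in> carrier E"
  shows "(\<Oplus>\<^bsub>E\<^esub>i\<in>{1..Suc n}. s i) = (\<Oplus>\<^bsub>E\<^esub>i\<in>{1..n}. s i) \<oplus> s (Suc n)"
proof -
  have "{1..Suc n} = insert (Suc n) {1..n}" by auto
  then have "(\<Oplus>\<^bsub>E\<^esub>i\<in>{1..Suc n}. s i) = s (Suc n) \<oplus> (\<Oplus>\<^bsub>E\<^esub>i\<in>{1..n}. s i)"
    using assms by (simp add: M.finsum_insert Pi_def)
  also have "\<dots> = (\<Oplus>\<^bsub>E\<^esub>i\<in>{1..n}. s i) \<oplus> s (Suc n)"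
    using assms by (intro M.a_comm M.finsum_closed) auto
  finally show ?thesis .
qed

lemma nfold_sums_Suc:
  assumes S: "S \<subseteq> carrier E"
  shows "v \<in> nfold_sums S (Suc n) \<longleftrightarrow> (\<exists>u\<in>nfold_sums S n. \<exists>z\<in>S. v = u \<oplus> z)"
proof
  assume "v \<in> nfold_sums S (Suc n)"
  then obtain s where s: "\<forall>i\<in>{1..Suc n}. s i \<in> S" and v: "v = (\<Oplus>\<^bsub>E\<^esub>i\<in>{1..Suc n}. s i)"
    unfolding nfold_sums_def by blast
  have "v = (\<Oplus>\<^bsub>E\<^esub>i\<in>{1..n}. s i) \<oplus> s (Suc n)"
    unfolding v using s S by (intro finsum_atLeastAtMost_Suc) blast
  moreover have "(\<Oplus>\<^bsub>E\<^esub>i\<in>{1..n}. s i) \<in> nfold_sums S n"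
    using s unfolding nfold_sums_def by fastforce
  moreover have "s (Suc n) \<in> S" using s by simp
  ultimately show "\<exists>u\<in>nfold_sums S n. \<exists>z\<in>S. v = u \<oplus> z" by blast
next
  assume "\<exists>u\<in>nfold_sums S n. \<exists>z\<in>S. v = u \<oplus> z"
  then obtain s z where s: "\<forall>i\<in>{1..n}. s i \<in> S" and z: "z \<in> S"
    and v: "v = (\<Oplus>\<^bsub>E\<^esub>i\<in>{1..n}. s i) \<oplus> z"
    unfolding nfold_sums_def by blast
  let ?s = "s(Suc n := z)"
  have "(\<Oplus>\<^bsub>E\<^esub>i\<in>{1..n}. s i) = (\<Oplus>\<^bsub>E\<^esub>i\<in>{1..n}. ?s i)"
    using s S by (intro M.finsum_cong') auto
  moreover have "(\<Oplus>\<^bsub>E\<^esub>i\<in>{1..Suc n}. ?s i) = (\<Oplus>\<^bsub>E\<^esub>i\<in>{1..n}. ?s i) \<oplus> ?s (Suc n)"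
    using s S z by (intro finsum_atLeastAtMost_Suc) (auto simp: le_Suc_eq)
  ultimately have "v = (\<Oplus>\<^bsub>E\<^esub>i\<in>{1..Suc n}. ?s i)" using v by simp
  moreover have "\<forall>i\<in>{1..Suc n}. ?s i \<in> S" using s z by (auto simp: le_Suc_eq)
  ultimately show "v \<in> nfold_sums S (Suc n)" unfolding nfold_sums_def by blast
qed

lemma nfold_sums_add:
  assumes S: "S \<subseteq> carrier E"
  shows "u \<in> nfold_sums S m \<Longrightarrow> v \<in> nfold_sums S n \<Longrightarrow> u \<oplus> v \<in> nfold_sums S (m + n)"
proof (induction n arbitrary: v)
  case 0
  then show ?case using nfold_sums_closed[OF S, of m] by (auto simp: nfold_sums_0)
next
  case (Suc n)
  then obtain v' z where v': "v' \<in> nfold_sums S n" and z: "z \<in> S" and v: "v = v' \<oplus> z"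
    by (auto simp: nfold_sums_Suc[OF S])
  have "u \<oplus> v = (u \<oplus> v') \<oplus> z"
    using nfold_sums_closed[OF S] Suc.prems(1) v' z S unfolding v
    by (intro M.a_assoc[symmetric]) blast+
  moreover have "u \<oplus> v' \<in> nfold_sums S (m + n)" by (rule Suc.IH[OF Suc.prems(1) v'])
  ultimately show ?case using z by (auto simp: nfold_sums_Suc[OF S])
qed

lemma L0_convex_hull_closed:
  assumes S: "S \<subseteq> carrier E"
  shows "L0_convex_hull M E S \<subseteq> carrier E"
proof
  fix v assume "v \<in> L0_convex_hull M E S"
  then obtain n :: nat and Y s where v: "v = (\<Oplus>\<^bsub>E\<^esub>i\<in>{1..n}. Y i \<odot> s i)"
    and Ys: "\<forall>i\<in>{1..n}. s i \<in> S \<and> Y i \<in> L0_plus M"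
    unfolding L0_convex_hull_def by blast
  show "v \<in> carrier E"
    unfolding v using Ys S by (intro M.finsum_closed) (auto simp: L0_plus_def)
qed

lemma finsum_L0_const: "(\<Oplus>\<^bsub>L0 M\<^esub>i\<in>{1..n::nat}. cls (\<lambda>_. c)) = cls (\<lambda>_. real n * c)"
proof (induction n)
  case 0
  then show ?case by (simp add: zero_L0)
next
  case (Suc n)
  have "{1..Suc n} = insert (Suc n) {1..n}" by auto
  then have "(\<Oplus>\<^bsub>L0 M\<^esub>i\<in>{1..Suc n}. cls (\<lambda>_. c))
      = cls (\<lambda>_. c) \<oplus>\<^bsub>L0 M\<^esub> (\<Oplus>\<^bsub>L0 M\<^esub>i\<in>{1..n}. cls (\<lambda>_. c))"
    by (simp add: R.finsum_insert Pi_def)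
  also have "\<dots> = cls (\<lambda>_. real (Suc n) * c)"
    unfolding Suc by (simp add: add_L0 algebra_simps)
  finally show ?case .
qed

lemma average_in_convex_hull:
  assumes S: "S \<subseteq> carrier E" and v: "v \<in> nfold_sums S n" and n: "1 \<le> n"
  shows "cls (\<lambda>_. 1 / real n) \<odot> v \<in> L0_convex_hull M E S"
proof -
  obtain s where s: "\<forall>i\<in>{1..n}. s i \<in> S" and v: "v = (\<Oplus>\<^bsub>E\<^esub>i\<in>{1..n}. s i)"
    using v unfolding nfold_sums_def by blast
  have "cls (\<lambda>_. 1 / real n) \<odot> v = (\<Oplus>\<^bsub>E\<^esub>i\<in>{1..n}. cls (\<lambda>_. 1 / real n) \<odot> s i)"
    unfolding v using s S by (intro finsum_smult_ldistr) auto
  moreover have "cls (\<lambda>_. 1 / real n) \<in> L0_plus M"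
    by (simp add: L0_plus_def zero_L0 L0_le_class)
  moreover have "(\<Oplus>\<^bsub>L0 M\<^esub>i\<in>{1..n}. cls (\<lambda>_. 1 / real n)) = \<one>\<^bsub>L0 M\<^esub>"
    unfolding finsum_L0_const using n by (simp add: one_L0)
  ultimately show ?thesis
    unfolding L0_convex_hull_def mem_Collect_eq using s n
    by (intro exI[of _ n] exI[of _ "\<lambda>_. cls (\<lambda>_. 1 / real n)"] exI[of _ s]) simp
qed

lemma nfold_sums_1:
  assumes S: "S \<subseteq> carrier E" and z: "z \<in> S"
  shows "z \<in> nfold_sums S 1"
proof -
  have "\<zero> \<oplus> z \<in> nfold_sums S (Suc 0)"
    using z by (subst nfold_sums_Suc[OF S]) (auto simp: nfold_sums_0)
  moreover have "\<zero> \<oplus> z = z" using S z by auto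
  ultimately show ?thesis by simp
qed

text \<open>Division by \<open>n\<close> turns the difference into \<open>x\<close> minus an average of elements
of \<open>S\<close>, which has seminorm at least \<open>d\<close>.\<close>

lemma nfold_distance:
  assumes S: "S \<subseteq> carrier E" and x: "x \<in> carrier E"
    and d: "\<And>z. z \<in> L0_convex_hull M E S \<Longrightarrow> AE w in M. d w \<le> N (x \<ominus> z) w"
    and v: "v \<in> nfold_sums S n"
  shows "AE w in M. real n * d w \<le> N (add_pow E n x \<ominus> v) w"
proof (cases "n = 0")
  case True
  have "add_pow E n x \<ominus> v \<in> carrier E" using x v nfold_sums_closed[OF S] by blast
  with True N_nonneg[of "add_pow E n x \<ominus> v"] show ?thesis by simp
next
  case False
  define c where "c = cls (\<lambda>_. 1 / real n)"
  have c: "c \<in> carrier (L0 M)" by (simp add: c_def)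
  have vE: "v \<in> carrier E" using v nfold_sums_closed[OF S] by blast
  have nx: "add_pow E n x \<in> carrier E" using x by simp
  have "c \<odot> add_pow E n x = cls (\<lambda>_. 1) \<odot> x"
    using x False by (simp add: c_def multiple_eq_smult cls_mult_smult)
  then have "c \<odot> (add_pow E n x \<ominus> v) = x \<ominus> c \<odot> v"
    using c vE nx x by (simp add: a_minus_def smult_r_distr smult_r_minus cls_one_smult)
  then have "AE w in M. N (x \<ominus> c \<odot> v) w = (1 / real n) * N (add_pow E n x \<ominus> v) w"
    using N_smult[of "add_pow E n x \<ominus> v" "\<lambda>_. 1 / real n"] nx vE by (simp add: c_def)
  moreover have "AE w in M. d w \<le> N (x \<ominus> c \<odot> v) w"
    unfolding c_def using False by (intro d average_in_convex_hull[OF S v]) simp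
  ultimately show ?thesis
  proof eventually_elim
    case (elim w)
    then have "real n * d w \<le> real n * N (x \<ominus> c \<odot> v) w" by (intro mult_left_mono) auto
    with elim(1) False show ?case by simp
  qed
qed

text \<open>If \<open>d\<close> is a lower bound on the distance from \<open>x\<close> to the convex hull of \<open>S\<close>, the pairs
\<open>(n x - v, n d)\<close>, with \<open>v\<close> a sum of \<open>n\<close> elements of \<open>S\<close>, form a dominated cone.
The sandwich theorem then supplies a continuous functional that keeps \<open>x\<close> at least
\<open>d\<close> away from every element of \<open>S\<close>, simultaneously on all of the probability space.\<close>

lemma separating_functional:
  assumes S: "S \<subseteq> carrier E" and x: "x \<in> carrier E" and d_meas: "d \<in> borel_measurable M"
    and d: "\<And>z. z \<in> L0_convex_hull M E S \<Longrightarrow> AE w in M. d w \<le> N (x \<ominus> z) w"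
  obtains f where "\<And>y. y \<in> carrier E \<Longrightarrow> f y \<in> borel_measurable M"
    "(\<lambda>y. cls (f y)) \<in> L0_dual M E nrm"
    "\<And>z. z \<in> S \<Longrightarrow> AE w in M. d w \<le> f (x \<ominus> z) w"
proof -
  define D where "D = {(add_pow E n x \<ominus> v, \<lambda>w. real n * d w) |n v. v \<in> nfold_sums S n}"
  have DI: "(u, c) \<in> D" if "u = add_pow E n x \<ominus> v" "c = (\<lambda>w. real n * d w)" "v \<in> nfold_sums S n"
    for u c n v
    using that by (auto simp: D_def)
  have "seminormed_group.dominated_cone D"
    unfolding seminormed_group.dominated_cone_def
  proof (intro conjI)
    show "D \<subseteq> carrier E \<times> borel_measurable M"
      using x d_meas nfold_sums_closed[OF S] by (auto simp: D_def)
    show "(\<zero>, \<lambda>_. 0) \<in> D"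
    proof -
      have "\<zero> \<ominus> \<zero> = \<zero>" by (simp add: a_minus_def M.minus_equality)
      then show ?thesis by (intro DI[of _ 0 \<zero>]) (simp_all add: nfold_sums_0)
    qed
    show "\<forall>(u, c)\<in>D. AE w in M. c w \<le> N u w"
      using nfold_distance[OF S x d] by (auto simp: D_def)
    have "(add_pow E m x \<ominus> u \<oplus> (add_pow E n x \<ominus> v), \<lambda>w. real m * d w + real n * d w) \<in> D"
      if uv: "u \<in> nfold_sums S m" "v \<in> nfold_sums S n" for u v and m n :: nat
    proof (rule DI[of _ "m + n" "u \<oplus> v"])
      have "u \<in> carrier E" "v \<in> carrier E" using uv nfold_sums_closed[OF S] by auto
      then show "add_pow E m x \<ominus> u \<oplus> (add_pow E n x \<ominus> v) = add_pow E (m + n) x \<ominus> (u \<oplus> v)"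
        using x by (simp add: a_minus_def M.add.nat_pow_mult[symmetric] M.minus_add M.a_ac)
      show "u \<oplus> v \<in> nfold_sums S (m + n)" by (rule nfold_sums_add[OF S uv])
    qed (simp add: algebra_simps)
    then show "\<forall>(u, c)\<in>D. \<forall>(v, e)\<in>D. (u \<oplus> v, \<lambda>w. c w + e w) \<in> D"
      unfolding D_def by fast
  qed
  from seminormed_group.dominating_additive_map[OF this]
  obtain f where f: "\<And>y. y \<in> carrier E \<Longrightarrow> f y \<in> borel_measurable M"
    "\<And>y z. \<lbrakk>y \<in> carrier E; z \<in> carrier E\<rbrakk> \<Longrightarrow> AE w in M. f (y \<oplus> z) w = f y w + f z w"
    "\<And>y. y \<in> carrier E \<Longrightarrow> AE w in M. \<bar>f y w\<bar> \<le> N y w"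
    "\<And>u c. (u, c) \<in> D \<Longrightarrow> AE w in M. c w \<le> f u w"
    by blast
  show ?thesis
  proof (rule that)
    show "f y \<in> borel_measurable M" if "y \<in> carrier E" for y by (rule f(1)[OF that])
    show "(\<lambda>y. cls (f y)) \<in> L0_dual M E nrm" by (rule additive_in_dual[OF f(1-3)])
    show "AE w in M. d w \<le> f (x \<ominus> z) w" if z: "z \<in> S" for z
    proof (rule f(4))
      show "(x \<ominus> z, d) \<in> D"
        by (rule DI[of _ 1 z]) (use x nfold_sums_1[OF S z] in auto)
    qed
  qed
qed

lemma openin_weak_strip:
  assumes F: "F \<in> L0_dual M E nrm" and x: "x \<in> carrier E" and c: "0 < (c::real)"
  shows "openin (weak_topology M E nrm)
    {y \<in> carrier E. L0_less M (L0_abs M (F (x \<ominus> y))) (cls (\<lambda>_. c))}" (is "openin _ ?U")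
  unfolding weak_topology_def openin_seminorm_topology seminorm_open_def
proof (intro conjI ballI)
  fix y assume "y \<in> ?U"
  then have y: "y \<in> carrier E" and less: "L0_less M (L0_abs M (F (x \<ominus> y))) (cls (\<lambda>_. c))" by auto
  have Fc: "F u \<in> carrier (L0 M)" if "u \<in> carrier E" for u
    using F that by (auto simp: L0_dual_def)
  have Fadd: "F (u \<oplus> v) = F u \<oplus>\<^bsub>L0 M\<^esub> F v" if "u \<in> carrier E" "v \<in> carrier E" for u v
    using F that by (auto simp: L0_dual_def)
  have Fsm: "F (Y \<odot> u) = Y \<otimes>\<^bsub>L0 M\<^esub> F u" if "Y \<in> carrier (L0 M)" "u \<in> carrier E" for Y u
    using F that by (auto simp: L0_dual_def)
  obtain g where g: "g \<in> borel_measurable M" "F (x \<ominus> y) = cls g"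
    using Fc[of "x \<ominus> y"] x y by (auto simp: carrier_L0)
  have gc: "AE w in M. \<bar>g w\<bar> < c" using less g by (simp add: L0_abs_class L0_less_class)
  \<comment> \<open>Half of the remaining room; the value 1 on the exceptional null set keeps the radius
      positive everywhere.\<close>
  let ?e = "\<lambda>w. if \<bar>g w\<bar> < c then (c - \<bar>g w\<bar>) / 2 else 1"
  have e_meas: "?e \<in> borel_measurable M" using g(1) by measurable
  have e: "cls ?e \<in> L0_pp M" using e_meas by (auto simp: L0_pp_iff intro!: bexI[of _ ?e])
  show "\<exists>Q \<epsilon>. finite Q \<and> Q \<subseteq> (\<lambda>f x. L0_abs M (f x)) ` L0_dual M E nrm \<and> \<epsilon> \<in> L0_pp M \<and>
          (\<forall>z\<in>L0_ball M E Q \<epsilon>. y \<oplus> z \<in> ?U)"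
  proof (intro exI[of _ "{\<lambda>x. L0_abs M (F x)}"] exI[of _ "cls ?e"] conjI ballI)
    fix z assume z: "z \<in> L0_ball M E {\<lambda>x. L0_abs M (F x)} (cls ?e)"
    then have zE: "z \<in> carrier E" and zle: "L0_le M (L0_abs M (F z)) (cls ?e)"
      by (auto simp: L0_ball_def)
    obtain h where h: "h \<in> borel_measurable M" "F z = cls h"
      using Fc[OF zE] by (auto simp: carrier_L0)
    have he: "AE w in M. \<bar>h w\<bar> \<le> ?e w" using zle h e_meas by (simp add: L0_abs_class L0_le_class)
    have "F (cls (\<lambda>_. - 1) \<odot> z) = cls (\<lambda>w. - h w)"
      using zE h by (simp add: Fsm mult_L0)
    then have "F (\<ominus> z) = cls (\<lambda>w. - h w)"
      using zE cls_uminus_smult[OF zE, of "\<lambda>_. 1"] by (simp add: cls_one_smult)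
    moreover have "x \<ominus> (y \<oplus> z) = (x \<ominus> y) \<oplus> \<ominus> z"
      using x y zE by (simp add: a_minus_def M.minus_add M.a_assoc)
    ultimately have "F (x \<ominus> (y \<oplus> z)) = cls (\<lambda>w. g w + - h w)"
      using x y zE g h by (simp add: Fadd add_L0)
    moreover from gc he have "AE w in M. \<bar>g w + - h w\<bar> < c"
      by eventually_elim (auto simp: field_simps)
    ultimately show "y \<oplus> z \<in> ?U"
      using y zE g h by (simp add: L0_abs_class L0_less_class)
  qed (use F e in auto)
qed auto

lemma weak_limit_value_small:
  assumes lim: "limitin (weak_topology M E nrm) X x (tail_filter \<Gamma> r)" and dir: "directed_on \<Gamma> r"
    and F: "F \<in> L0_dual M E nrm" and x: "x \<in> carrier E" and c: "0 < (c::real)"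
  obtains i where "i \<in> \<Gamma>" "X i \<in> carrier E" "L0_less M (L0_abs M (F (x \<ominus> X i))) (cls (\<lambda>_. c))"
proof -
  let ?U = "{y \<in> carrier E. L0_less M (L0_abs M (F (x \<ominus> y))) (cls (\<lambda>_. c))}"
  have "F (cls (\<lambda>_. 0) \<odot> x) = cls (\<lambda>_. 0) \<otimes>\<^bsub>L0 M\<^esub> F x"
    using F x by (auto simp: L0_dual_def)
  moreover have "F x \<in> carrier (L0 M)" using F x by (auto simp: L0_dual_def)
  ultimately have "F \<zero> = cls (\<lambda>_. 0)"
    using x by (auto simp: cls_zero_smult carrier_L0 mult_L0)
  then have "x \<in> ?U" using x c by (simp add: a_minus_def M.r_neg L0_abs_class L0_less_class)
  then have "eventually (\<lambda>i. X i \<in> ?U) (tail_filter \<Gamma> r)"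
    using lim openin_weak_strip[OF F x c] by (auto simp: limitin_def)
  then obtain a where "a \<in> \<Gamma>" "\<forall>b\<in>\<Gamma>. (a, b) \<in> r \<longrightarrow> X b \<in> ?U"
    by (auto simp: eventually_tail_filter[OF dir])
  moreover have "(a, a) \<in> r" if "a \<in> \<Gamma>" for a
    using dir that by (auto simp: directed_on_def preorder_on_def refl_on_def)
  ultimately show ?thesis using that by blast
qed

end

section \<open>Countable concatenations\<close>

text \<open>The sets \<open>B n\<close> are made disjoint; the null set that they miss is added to the first of them, since
a partition has to exhaust the space and not only almost all of it.\<close>

lemma ctbl_partition_subordinate:
  fixes M :: "'w measure" and B :: "nat \<Rightarrow> 'w set"
  assumes B: "\<And>n. B n \<in> sets M" and cover: "AE w in M. \<exists>n. w \<in> B n"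
  obtains A where "ctbl_partition M A" "\<And>n. AE w in M. w \<in> A n \<longrightarrow> w \<in> B n"
proof
  define B' where "B' n = (if n = 0 then B 0 \<union> (space M - (\<Union>n. B n)) else B n)" for n
  have B': "B' n \<in> sets M" for n unfolding B'_def using B by auto
  show "ctbl_partition M (disjointed B')"
    unfolding ctbl_partition_def
  proof (intro conjI)
    show "range (disjointed B') \<subseteq> sets M"
      using B' by (intro sets.range_disjointed_sets) auto
    show "disjoint_family (disjointed B')" by (rule disjoint_family_disjointed)
    have "(\<Union>n. B' n) = space M"
    proof (intro equalityI subsetI)
      fix w assume "w \<in> (\<Union>n. B' n)"
      then show "w \<in> space M" using B' sets.sets_into_space by blast
    next
      fix w assume "w \<in> space M"
      show "w \<in> (\<Union>n. B' n)"
      proof (cases "\<exists>n. w \<in> B n")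
        case True
        then obtain n where "w \<in> B n" by blast
        then have "w \<in> B' n" by (auto simp: B'_def)
        then show ?thesis by blast
      next
        case False
        with \<open>w \<in> space M\<close> have "w \<in> B' 0" by (auto simp: B'_def)
        then show ?thesis by blast
      qed
    qed
    then show "(\<Union>n. disjointed B' n) = space M" by (simp add: UN_disjointed_eq)
  qed
  fix n
  show "AE w in M. w \<in> disjointed B' n \<longrightarrow> w \<in> B n"
    using cover
  proof eventually_elim
    case (elim w)
    then show ?case using disjointed_subset[of B' n] by (auto simp: B'_def split: if_splits)
  qed
qed

context L0_seminormed_module
begin

lemma ind_smult_Int:
  assumes "A \<in> sets M" "B \<in> sets M" "y \<in> carrier E"
  shows "L0_ind M (A \<inter> B) \<odot> y = L0_ind M A \<odot> (L0_ind M B \<odot> y)"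
proof -
  have "L0_ind M A \<odot> (L0_ind M B \<odot> y) = cls (\<lambda>w. indicator A w * indicator B w) \<odot> y"
    unfolding L0_ind_def using assms by (intro cls_mult_smult) auto
  also have "(\<lambda>w. indicator A w * indicator B w :: real) = indicator (A \<inter> B)"
    by (auto simp: indicator_def)
  finally show ?thesis by (simp add: L0_ind_def)
qed

lemma ind_in_carrier [simp, intro]: "A \<in> sets M \<Longrightarrow> L0_ind M A \<in> carrier (L0 M)"
  by (simp add: L0_ind_def)

lemma N_ind_smult:
  assumes "A \<in> sets M" "y \<in> carrier E"
  shows "AE w in M. N (L0_ind M A \<odot> y) w = indicator A w * N y w"
  using N_smult[OF assms(2), of "indicator A"] assms by (simp add: L0_ind_def)

text \<open>A concatenation of concatenations is a concatenation over the common refinement of the partitions,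
enumerated through the pairing function on the natural numbers.\<close>

lemma rel_cc_property_cc_closure:
  assumes K: "K \<subseteq> carrier E"
  shows "rel_cc_property M E (cc_closure M E K)"
  unfolding rel_cc_property_def
proof (intro allI impI subsetI)
  fix A X x
  assume AX: "ctbl_partition M A \<and> range X \<subseteq> cc_closure M E K" and x: "x \<in> cc M E A X"
  have "\<forall>n. \<exists>B Y. ctbl_partition M B \<and> range Y \<subseteq> K \<and> X n \<in> cc M E B Y"
  proof
    fix n have "X n \<in> cc_closure M E K" using AX by blast
    then show "\<exists>B Y. ctbl_partition M B \<and> range Y \<subseteq> K \<and> X n \<in> cc M E B Y"
      unfolding cc_closure_def by blast
  qed
  then obtain B Y where B: "\<And>n. ctbl_partition M (B n)" and Y: "\<And>n. range (Y n) \<subseteq> K"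
    and XB: "\<And>n. X n \<in> cc M E (B n) (Y n)"
    by metis
  have sets: "A n \<in> sets M" "B n m \<in> sets M" for n m
    using AX B[of n] by (simp_all add: ctbl_partition_def image_subset_iff)
  define C where "C k = A (fst (prod_decode k)) \<inter> B (fst (prod_decode k)) (snd (prod_decode k))" for k
  define Z where "Z k = Y (fst (prod_decode k)) (snd (prod_decode k))" for k
  have "ctbl_partition M C"
    unfolding ctbl_partition_def
  proof (intro conjI)
    show "range C \<subseteq> sets M" using sets by (auto simp: C_def)
    have disj: "A n \<inter> A m = {}" "B k n \<inter> B k m = {}" if "n \<noteq> m" for n m k
      using AX B[of k] that by (auto simp: ctbl_partition_def disjoint_family_on_def)
    show "disjoint_family C"
      unfolding disjoint_family_on_def
    proof (intro ballI impI)
      fix k l :: nat assume "k \<noteq> l"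
      then have "prod_decode k \<noteq> prod_decode l" by (simp add: inj_eq[OF inj_prod_decode])
      then show "C k \<inter> C l = {}"
        using disj unfolding C_def prod_eq_iff by (metis (no_types, opaque_lifting) Int_assoc Int_commute Int_empty_left Int_empty_right)
    qed
    show "(\<Union>k. C k) = space M"
    proof (intro equalityI subsetI)
      fix w assume "w \<in> (\<Union>k. C k)"
      then show "w \<in> space M" using sets sets.sets_into_space by (fastforce simp: C_def)
    next
      fix w assume w: "w \<in> space M"
      have "w \<in> (\<Union>n. A n)" using AX w by (simp add: ctbl_partition_def)
      then obtain n where n: "w \<in> A n" by blast
      have "w \<in> (\<Union>m. B n m)" using B[of n] w by (simp add: ctbl_partition_def)
      then obtain m where "w \<in> B n m" by blast
      with n have "w \<in> C (prod_encode (n, m))" by (simp add: C_def)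
      then show "w \<in> (\<Union>k. C k)" by blast
    qed
  qed
  moreover have "range Z \<subseteq> K" using Y by (auto simp: Z_def)
  moreover have "x \<in> cc M E C Z"
    unfolding cc_def
  proof (intro CollectI conjI allI)
    show xE: "x \<in> carrier E" using x by (simp add: cc_def)
    fix k
    obtain n m where nm: "prod_decode k = (n, m)" by (cases "prod_decode k")
    have YE: "Y n m \<in> carrier E" and XE: "X n \<in> carrier E"
      using Y K XB by (auto simp: cc_def)
    have "L0_ind M (A n) \<odot> (L0_ind M (B n m) \<odot> Y n m) = L0_ind M (A n) \<odot> (L0_ind M (B n m) \<odot> X n)"
      using XB[of n] by (simp add: cc_def)
    also have "\<dots> = L0_ind M (B n m) \<odot> (L0_ind M (A n) \<odot> X n)"
      using XE sets by (simp add: ind_smult_Int[symmetric] Int_commute)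
    also have "\<dots> = L0_ind M (B n m) \<odot> (L0_ind M (A n) \<odot> x)"
      using x by (simp add: cc_def)
    finally show "L0_ind M (C k) \<odot> Z k = L0_ind M (C k) \<odot> x"
      using YE xE sets by (simp add: C_def Z_def nm ind_smult_Int) (simp add: ind_smult_Int[symmetric] Int_commute)
  qed
  ultimately show "x \<in> cc_closure M E K" unfolding cc_closure_def by blast
qed

lemma rel_cc_property_ball:
  assumes e: "e \<in> borel_measurable M"
  shows "rel_cc_property M E (L0_ball M E {nrm} (cls e))"
  unfolding rel_cc_property_def
proof (intro allI impI subsetI)
  fix A X x
  assume AX: "ctbl_partition M A \<and> range X \<subseteq> L0_ball M E {nrm} (cls e)" and x: "x \<in> cc M E A X"
  have xE: "x \<in> carrier E" using x by (simp add: cc_def)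
  have A: "A n \<in> sets M" for n using AX by (auto simp: ctbl_partition_def)
  have "AE w in M. w \<in> A n \<longrightarrow> N x w \<le> e w" for n
  proof -
    have Xn: "X n \<in> L0_ball M E {nrm} (cls e)" using AX by blast
    then have XE: "X n \<in> carrier E" by (simp add: L0_ball_def)
    have Xe: "AE w in M. N (X n) w \<le> e w" using Xn XE e by (simp add: L0_ball_def nrm_le_iff)
    have eq: "L0_ind M (A n) \<odot> X n = L0_ind M (A n) \<odot> x" using x by (simp add: cc_def)
    from Xe N_ind_smult[OF A XE, of n, unfolded eq] N_ind_smult[OF A xE, of n]
    show ?thesis by eventually_elim (auto simp: indicator_def)
  qed
  then have "AE w in M. \<forall>n. w \<in> A n \<longrightarrow> N x w \<le> e w" unfolding AE_all_countable by blast
  then have "AE w in M. N x w \<le> e w"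
    using AE_space
  proof eventually_elim
    case (elim w)
    then show ?case using AX by (auto simp: ctbl_partition_def)
  qed
  then show "x \<in> L0_ball M E {nrm} (cls e)" using xE e by (simp add: L0_ball_def nrm_le_iff)
qed

lemma subset_cc_closure:
  assumes K: "K \<subseteq> carrier E" and A: "ctbl_partition M A"
  shows "K \<subseteq> cc_closure M E K"
proof
  fix z assume "z \<in> K"
  then have "z \<in> cc M E A (\<lambda>_. z)" "range (\<lambda>_::nat. z) \<subseteq> K" using K by (auto simp: cc_def)
  then show "z \<in> cc_closure M E K" unfolding cc_closure_def using A by blast
qed

text \<open>The concatenation of the \<open>z n\<close> along the sets where \<open>z n\<close> is close to \<open>x\<close> need not
exist in the module. But \<open>x\<close> itself is a concatenation of the sums \<open>z n \<oplus> b n\<close>, where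
\<open>b n\<close> is \<open>x \<ominus> z n\<close> cut off outside the \<open>n\<close>-th piece and hence lies in the ball. As the
concatenation closure and the ball have the relative countable concatenation property, so does
their sum, which therefore contains \<open>x\<close>.\<close>

lemma cc_closure_approximation:
  assumes pres: "sum_preserves_rel_cc M E"
    and C: "C \<subseteq> carrier E" and x: "x \<in> carrier E" and e: "e \<in> borel_measurable M"
    and z: "\<And>n::nat. z n \<in> C" and near: "AE w in M. \<exists>n. N (x \<ominus> z n) w \<le> e w"
    and e0: "AE w in M. 0 \<le> e w"
  shows "\<exists>Z\<in>cc_closure M E C. L0_le M (nrm (x \<ominus> Z)) (cls e)"
proof -
  have zE: "z n \<in> carrier E" for n using z C by blast
  define B where "B n = {w \<in> space M. N (x \<ominus> z n) w \<le> e w}" for n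
  have B: "B n \<in> sets M" for n
  proof -
    have [measurable]: "N (x \<ominus> z n) \<in> borel_measurable M" using x zE by (intro N_measurable) auto
    note [measurable] = e
    show ?thesis unfolding B_def by measurable
  qed
  have cover: "AE w in M. \<exists>n. w \<in> B n"
    using near AE_space by eventually_elim (auto simp: B_def)
  obtain A where part: "ctbl_partition M A" and AB: "\<And>n. AE w in M. w \<in> A n \<longrightarrow> w \<in> B n"
    using ctbl_partition_subordinate[OF B cover] by blast
  have A: "A n \<in> sets M" for n using part by (auto simp: ctbl_partition_def)
  let ?b = "\<lambda>n. L0_ind M (A n) \<odot> (x \<ominus> z n)"
  let ?K = "cc_closure M E C" and ?V = "L0_ball M E {nrm} (cls e)"
  have bE: "?b n \<in> carrier E" for n using x zE A by auto
  have b: "?b n \<in> ?V" for n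
  proof -
    have "x \<ominus> z n \<in> carrier E" using x zE by auto
    from N_ind_smult[OF A this, of n] AB[of n] e0
    have "AE w in M. N (?b n) w \<le> e w"
      by eventually_elim (auto simp: indicator_def B_def)
    then show ?thesis using bE e by (simp add: L0_ball_def nrm_le_iff)
  qed
  have "L0_ind M (A n) \<odot> (z n \<oplus> ?b n) = L0_ind M (A n) \<odot> x" for n
  proof -
    have "L0_ind M (A n) \<odot> ?b n = ?b n"
      using ind_smult_Int[OF A A, of "x \<ominus> z n" n n] x zE by simp
    then have "L0_ind M (A n) \<odot> (z n \<oplus> ?b n) = L0_ind M (A n) \<odot> z n \<oplus> L0_ind M (A n) \<odot> (x \<ominus> z n)"
      using bE zE A by (simp add: smult_r_distr)
    also have "\<dots> = L0_ind M (A n) \<odot> (z n \<oplus> (x \<ominus> z n))"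
      using x zE A by (simp add: smult_r_distr)
    also have "z n \<oplus> (x \<ominus> z n) = x"
      using x zE by (simp add: a_minus_def M.a_lcomm M.r_neg)
    finally show ?thesis .
  qed
  then have "x \<in> cc M E A (\<lambda>n. z n \<oplus> ?b n)" using x by (simp add: cc_def)
  moreover have "rel_cc_property M E (?K <+>\<^bsub>E\<^esub> ?V)"
  proof -
    have "?K \<subseteq> carrier E" by (auto simp: cc_closure_def cc_def)
    moreover have "?V \<subseteq> carrier E" by (auto simp: L0_ball_def)
    ultimately show ?thesis
      using pres rel_cc_property_cc_closure[OF C] rel_cc_property_ball[OF e]
      unfolding sum_preserves_rel_cc_def by blast
  qed
  moreover have "range (\<lambda>n. z n \<oplus> ?b n) \<subseteq> ?K <+>\<^bsub>E\<^esub> ?V"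
    using subset_cc_closure[OF C part] z b by (fastforce simp: set_add_def')
  ultimately have "x \<in> ?K <+>\<^bsub>E\<^esub> ?V"
    using part unfolding rel_cc_property_def by blast
  then obtain Z v where Z: "Z \<in> ?K" and v: "v \<in> ?V" and xZ: "x = Z \<oplus> v"
    by (auto simp: set_add_def')
  have "Z \<in> carrier E" "v \<in> carrier E" using Z v by (auto simp: cc_closure_def cc_def L0_ball_def)
  then have "x \<ominus> Z = v"
    unfolding xZ a_minus_def by (simp add: M.a_comm[of Z v] M.a_assoc M.r_neg)
  with v have "L0_le M (nrm (x \<ominus> Z)) (cls e)" by (simp add: L0_ball_def)
  with Z show ?thesis by blast
qed

end


section \<open>Approximation of weak limits in norm\<close>

theorem theorem3p1:
  fixes M :: "'w measure"
    and E :: "(('w \<Rightarrow> real) set, 'e) module"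
    and nrm :: "'e \<Rightarrow> ('w \<Rightarrow> real) set"
    and \<Gamma> :: "'i set" and r :: "'i rel"
    and X :: "'i \<Rightarrow> 'e" and x :: 'e
    and \<epsilon> :: "('w \<Rightarrow> real) set"
  assumes "prob_space M"
    and "L0_normed_module M E nrm"
    and "sum_preserves_rel_cc M E"
    and "directed_on \<Gamma> r"
    and "X \<in> \<Gamma> \<rightarrow> carrier E" and "x \<in> carrier E"
    and "limitin (weak_topology M E nrm) X x (tail_filter \<Gamma> r)"
    and "\<epsilon> \<in> L0_pp M"
  shows "\<exists>Z\<in>cc_closure M E (L0_convex_hull M E (X ` \<Gamma>)).
           L0_le M (nrm (x \<ominus>\<^bsub>E\<^esub> Z)) \<epsilon>"
proof -
  interpret prob_space M by fact
  interpret Module.module "L0 M" E using assms(2) by (simp add: L0_normed_module_def)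
  interpret L0_seminormed_module M E nrm
    using assms(2) by unfold_locales (simp add: L0_normed_module_def L0_norm_def)
  obtain e where e: "e \<in> borel_measurable M" "\<epsilon> = L0_class M e" "AE w in M. 0 < e w"
    using assms(8) by (auto simp: L0_pp_iff)
  define S where "S = X ` \<Gamma>"
  have S: "S \<subseteq> carrier E" using assms(5) by (auto simp: S_def)
  note C = L0_convex_hull_closed[OF S]
  define F where "F = (\<lambda>z. N (x \<ominus>\<^bsub>E\<^esub> z)) ` L0_convex_hull M E S"
  have F_ne: "F \<noteq> {}"
  proof -
    obtain i where "i \<in> \<Gamma>" using assms(4) by (auto simp: directed_on_def)
    then have "X i \<in> nfold_sums S 1" by (intro nfold_sums_1[OF S]) (simp add: S_def)
    from average_in_convex_hull[OF S this] show ?thesis by (auto simp: F_def)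
  qed
  have F_meas: "F \<subseteq> borel_measurable M"
    using assms(6) C by (auto simp: F_def intro!: N_measurable)
  have F_nonneg: "AE w in M. 0 \<le> g w" if "g \<in> F" for g
    using that assms(6) C by (auto simp: F_def intro!: N_nonneg)
  obtain h t where h: "h \<in> borel_measurable M" and t: "range t \<subseteq> F"
    and h_le: "\<And>g. g \<in> F \<Longrightarrow> AE w in M. h w \<le> g w"
    and t_near: "AE w in M. \<forall>a>0. \<exists>n::nat. t n w < h w + a"
  proof (rule essential_infimum[OF F_ne F_meas])
    show "(\<lambda>_. 0) \<in> borel_measurable M" by simp
  qed (rule F_nonneg, assumption, rule that)
  have "\<forall>n. \<exists>z\<in>L0_convex_hull M E S. t n = N (x \<ominus>\<^bsub>E\<^esub> z)"
    using t by (auto simp: F_def)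
  then obtain z where z: "\<And>n. z n \<in> L0_convex_hull M E S" "\<And>n. t n = N (x \<ominus>\<^bsub>E\<^esub> z n)"
    by metis
  have "AE w in M. h w \<le> N (x \<ominus>\<^bsub>E\<^esub> y) w" if "y \<in> L0_convex_hull M E S" for y
    using that by (intro h_le) (simp add: F_def)
  from separating_functional[OF S assms(6) h this]
  obtain f where f: "\<And>y. y \<in> carrier E \<Longrightarrow> f y \<in> borel_measurable M"
    "(\<lambda>y. cls (f y)) \<in> L0_dual M E nrm" "\<And>y. y \<in> S \<Longrightarrow> AE w in M. h w \<le> f (x \<ominus>\<^bsub>E\<^esub> y) w"
    by blast
  \<comment> \<open>The functional separates by \<open>h\<close> on the whole net, while its values at \<open>x \<ominus> X i\<close> become
      arbitrarily small.\<close>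
  have "AE w in M. h w \<le> 1 / real (Suc m)" for m
  proof -
    obtain i where i: "i \<in> \<Gamma>" "X i \<in> carrier E"
      "L0_less M (L0_abs M (cls (f (x \<ominus>\<^bsub>E\<^esub> X i)))) (cls (\<lambda>_. 1 / real (Suc m)))"
      using weak_limit_value_small[OF assms(7,4) f(2) assms(6), of "1 / real (Suc m)"] by auto
    have "x \<ominus>\<^bsub>E\<^esub> X i \<in> carrier E" using i(2) assms(6) by simp
    then have "AE w in M. \<bar>f (x \<ominus>\<^bsub>E\<^esub> X i) w\<bar> < 1 / real (Suc m)"
      using i(3) f(1) by (simp add: L0_abs_class L0_less_class)
    moreover have "AE w in M. h w \<le> f (x \<ominus>\<^bsub>E\<^esub> X i) w"
      using i(1) by (intro f(3)) (simp add: S_def)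
    ultimately show ?thesis by eventually_elim linarith
  qed
  then have h_small: "AE w in M. \<forall>m. h w \<le> 1 / real (Suc m)" unfolding AE_all_countable by blast
  have near: "AE w in M. \<exists>n. N (x \<ominus>\<^bsub>E\<^esub> z n) w \<le> e w"
    using h_small t_near e(3)
  proof eventually_elim
    case (elim w)
    have "h w \<le> 0"
    proof (rule ccontr)
      assume "\<not> h w \<le> 0"
      then obtain m where "1 / real (Suc m) < h w" using nat_approx_posE[of "h w"] by auto
      with elim(1) show False by (meson not_le)
    qed
    moreover obtain n where "t n w < h w + e w" using elim by blast
    ultimately show ?case by (auto simp: z(2) intro!: exI[of _ n])
  qed
  have "AE w in M. 0 \<le> e w" using e(3) by eventually_elim simp
  from cc_closure_approximation[OF assms(3) C assms(6) e(1) z(1) near this]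
  show ?thesis by (simp add: e(2) S_def)
qed

end
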